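(* Let $(E,d,m)$ be a locally compact, separable, connected metric measure space with $\mathrm{diam}(E)=1$, $m(E)<\infty$ and $\mathrm{supp}[m]=E$. Let $X$ be an $m$-symmetric Hunt process on $E$ with transition density $p_t(\cdot,\cdot)$ with respect to $m$. Suppose there exist positive constants $c_1,\dots,c_4$, $d_{\mathrm f}\ge1$ and $d_{\mathrm w}\ge2$ such that $$c_1t^{-d_{\mathrm f}/d_{\mathrm w}}\le p_t(x,x),$$ $$p_t(x,y)\le c_2\Bigl\{t^{-d_{\mathrm f}/d_{\mathrm w}}\wedge\frac{t}{d(x,y)^{d_{\mathrm f}+d_{\mathrm w}}}\Bigr\},$$ $$c_3r^{d_{\mathrm f}}\le m(B(x,r))\le c_4r^{d_{\mathrm f}}$$ for all $x,y\in E$, $r\in(0,1]$ and $t\in(0,1]$. If an integer $p\ge2$ satisfies $d_{\mathrm f}-p(d_{\mathrm f}-d_{\mathrm w})>0$, then $X$ satisfies Assumption (A) for this $p$ (defined in the context).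
   Context: Assumption (A) for an $m$-symmetric Hunt process $X$ with transition probabilities $p_t(x,dy)$ and $L^2(E;m)$-semigroup $\{T_t\}$, and an integer $p\ge2$, means that all of the following hold: (A1) for every $\varepsilon>0$ there is a compact $K\subset E$ with $\sup_{x\in E}R_1 1_{K^c}(x)\le\varepsilon$, where $R_1g(x)=\int_0^\infty e^{-t}\int_E g(y)p_t(x,dy)\,dt$; (A2) for each $t>0$, $x\in E$, $p_t(x,dy)$ is absolutely continuous with respect to $m$, and its density $p_t(\cdot,\cdot)$ is continuous and uniformly bounded on $E\times E$; (A3) there exist $\rho>0$, $t_0>0$, $C>0$ with $C^{-1}t^{-\rho/2}\le\int_E p_t(x,x)\,m(dx)\le Ct^{-\rho/2}$ for all $t\in(0,t_0]$; (A4) there exist $\mu\in(2,\frac{2p}{p-1})$, $C>0$, $t_0>0$ with $\|T_t\|_{L^1\to L^\infty}\le Ct^{-\mu/2}$ for all $t\in(0,t_0]$; (A5) $\sup_{x\in E}\int_E R_1(x,y)^p\,m(dy)<\infty$ and $\lim_{\delta\downarrow0}\sup_{x\in E}\int_E R_{1,\delta}(x,y)^p\,m(dy)=0$, where $R_1(x,y)=\int_0^\infty e^{-t}p_t(x,y)\,dt$ and $R_{1,\delta}(x,y)=\int_0^\delta e^{-t}p_t(x,y)\,dt$. $B(x,r)$ is the ball of radius $r$ centered at $x$; $a\wedge b=\min(a,b)$ (the second term being $+\infty$ when $x=y$).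
   Formalization: The formal theorem additionally assumes that y ↦ p_t(x,y) is continuous for every t>0 and x; without it (A2) can fail, e.g. for non-crossing reflected Brownian motions on two 3-balls touching at a point. *)

theory Defs
  imports "HOL-Probability.Probability"
begin

text \<open>
  The state space \<open>E\<close> is the whole type \<open>'a\<close>. The state space with cemetery, \<open>E\<close> together with
  \<open>\<Delta>\<close>, is \<open>'a option\<close>, where \<open>None\<close> is the cemetery \<open>\<Delta>\<close>. It carries the topology of the one-point
  compactification of \<open>E\<close>; if \<open>E\<close> is already compact, this makes \<open>\<Delta>\<close> an isolated point.
\<close>

abbreviation cemetery_topology :: "'a::topological_space option topology" where
  "cemetery_topology \<equiv> Alexandroff_compactification euclidean"

definition cemetery_borel :: "'a::topological_space option measure" where
  "cemetery_borel = sigma UNIV {U. openin cemetery_topology U}"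


section \<open>Hunt processes\<close>

text \<open>
  Time is \<open>ennreal\<close>, i.e. \<open>[0, \<infinity>]\<close>, so that a path has a value at \<open>\<infinity>\<close> and stopping times may be
  infinite. The filtration is \<open>F\<close>, and \<open>F \<infinity>\<close> plays the role of the ambient sigma-algebra on \<open>\<Omega>\<close>;
  only the sigma-algebra of each \<open>F t\<close> matters, the probabilities being the \<open>P x\<close>.
  The Markov and strong Markov properties and quasi-left-continuity are required under every \<open>P x\<close>;
  for an initial law \<open>\<mu>\<close> they follow by integrating over \<open>\<mu>\<close>.
\<close>

locale markov_process = filtration \<Omega> F
  for \<Omega> :: "'w set" and F :: "ennreal \<Rightarrow> 'w measure" +
  fixes X :: "ennreal \<Rightarrow> 'w \<Rightarrow> 'a::metric_space option"
    and P :: "'a option \<Rightarrow> 'w measure"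
  assumes prob_space_P: "\<And>x. prob_space (P x)"
    and sets_P: "\<And>x. sets (P x) = sets (F \<infinity>)"
    and adapted: "\<And>t. X t \<in> F t \<rightarrow>\<^sub>M cemetery_borel"
    and measurable_P: "\<And>t B. B \<in> sets cemetery_borel \<Longrightarrow>
          (\<lambda>x. measure (P x) {\<omega> \<in> \<Omega>. X t \<omega> \<in> B}) \<in> borel_measurable cemetery_borel"
    and markov: "\<And>x s t B. s < \<infinity> \<Longrightarrow> t < \<infinity> \<Longrightarrow> B \<in> sets cemetery_borel \<Longrightarrow>
          AE \<omega> in P x.
            real_cond_exp (P x) (F t) (indicat_real {\<omega> \<in> \<Omega>. X (t + s) \<omega> \<in> B}) \<omega>
              = measure (P (X t \<omega>)) {\<omega>' \<in> \<Omega>. X s \<omega>' \<in> B}"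
    and cemetery_trap: "\<And>t. AE \<omega> in P None. X t \<omega> = None"
    and normal: "\<And>x. AE \<omega> in P x. X 0 \<omega> = x"

definition lifetime :: "(ennreal \<Rightarrow> 'w \<Rightarrow> 'a option) \<Rightarrow> 'w \<Rightarrow> ennreal" where
  "lifetime X \<omega> = Inf {t. X t \<omega> = None}"

locale hunt_process = markov_process \<Omega> F X P
  for \<Omega> :: "'w set" and F :: "ennreal \<Rightarrow> 'w measure"
    and X :: "ennreal \<Rightarrow> 'w \<Rightarrow> 'a::metric_space option"
    and P :: "'a option \<Rightarrow> 'w measure" +
  fixes \<theta> :: "ennreal \<Rightarrow> 'w \<Rightarrow> 'w"
  assumes X_infinity: "\<And>\<omega>. \<omega> \<in> \<Omega> \<Longrightarrow> X \<infinity> \<omega> = None"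
    and X_after_lifetime: "\<And>t \<omega>. \<omega> \<in> \<Omega> \<Longrightarrow> lifetime X \<omega> \<le> t \<Longrightarrow> X t \<omega> = None"
    and shift_space: "\<And>t \<omega>. t < \<infinity> \<Longrightarrow> \<omega> \<in> \<Omega> \<Longrightarrow> \<theta> t \<omega> \<in> \<Omega>"
    and shift: "\<And>s t \<omega>. t < \<infinity> \<Longrightarrow> \<omega> \<in> \<Omega> \<Longrightarrow> X s (\<theta> t \<omega>) = X (s + t) \<omega>"
    and right_continuous_paths: "\<And>t \<omega>. t < \<infinity> \<Longrightarrow> \<omega> \<in> \<Omega> \<Longrightarrow>
          limitin cemetery_topology (\<lambda>s. X s \<omega>) (X t \<omega>) (at_right t)"
    and left_limits: "\<And>t \<omega>. 0 < t \<Longrightarrow> t < \<infinity> \<Longrightarrow> \<omega> \<in> \<Omega> \<Longrightarrow>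
          \<exists>l. limitin cemetery_topology (\<lambda>s. X s \<omega>) l (at_left t)"
    and right_continuous_filtration: "\<And>t. t < \<infinity> \<Longrightarrow> sets (F t) = (\<Inter>s\<in>{t<..}. sets (F s))"
    and strong_markov: "\<And>x s \<sigma> B. stopping_time F \<sigma> \<Longrightarrow> s < \<infinity> \<Longrightarrow> B \<in> sets cemetery_borel \<Longrightarrow>
          AE \<omega> in P x.
            real_cond_exp (P x) (pre_sigma \<sigma>) (indicat_real {\<omega> \<in> \<Omega>. X (\<sigma> \<omega> + s) \<omega> \<in> B}) \<omega>
              = measure (P (X (\<sigma> \<omega>) \<omega>)) {\<omega>' \<in> \<Omega>. X s \<omega>' \<in> B}"
    and quasi_left_continuous: "\<And>x \<sigma>. (\<And>n. stopping_time F (\<sigma> n)) \<Longrightarrow>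
          (\<And>\<omega>. \<omega> \<in> \<Omega> \<Longrightarrow> incseq (\<lambda>n. \<sigma> n \<omega>)) \<Longrightarrow>
          AE \<omega> in P x. (SUP n. \<sigma> n \<omega>) < \<infinity> \<longrightarrow>
            limitin cemetery_topology (\<lambda>n. X (\<sigma> n \<omega>) \<omega>) (X (SUP n. \<sigma> n \<omega>) \<omega>) sequentially"

text \<open>The transition probability \<open>p\<^sub>t(x, dy)\<close> is a sub-probability on \<open>E\<close>: the mass at \<open>\<Delta>\<close> is dropped.\<close>

definition trans_prob ::
  "('a::metric_space option \<Rightarrow> 'w measure) \<Rightarrow> (ennreal \<Rightarrow> 'w \<Rightarrow> 'a option) \<Rightarrow> real \<Rightarrow> 'a \<Rightarrow> 'a measure"
where
  "trans_prob P X t x = measure_of UNIV (sets borel)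
     (\<lambda>B. emeasure (P (Some x)) {\<omega> \<in> space (P (Some x)). X (ennreal t) \<omega> \<in> Some ` B})"

locale symmetric_hunt_process = hunt_process \<Omega> F X P \<theta>
  for \<Omega> :: "'w set" and F :: "ennreal \<Rightarrow> 'w measure"
    and X :: "ennreal \<Rightarrow> 'w \<Rightarrow> 'a::metric_space option"
    and P :: "'a option \<Rightarrow> 'w measure" and \<theta> :: "ennreal \<Rightarrow> 'w \<Rightarrow> 'w" +
  fixes m :: "'a measure"
  assumes sets_m: "sets m = sets borel"
    and symmetric: "\<And>t f g. 0 < t \<Longrightarrow> f \<in> borel_measurable borel \<Longrightarrow> g \<in> borel_measurable borel \<Longrightarrow>
          (\<integral>\<^sup>+x. f x * (\<integral>\<^sup>+y. g y \<partial>trans_prob P X t x) \<partial>m)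
            = (\<integral>\<^sup>+x. (\<integral>\<^sup>+y. f y \<partial>trans_prob P X t x) * g x \<partial>m)"

text \<open>
  This fixes \<open>q t x\<close> only up to \<open>m\<close>-null sets, so pointwise statements about \<open>q\<close> refer to the chosen
  version. No continuity, symmetry or Chapman-Kolmogorov identity is built in.
\<close>

definition transition_density ::
  "('a::metric_space option \<Rightarrow> 'w measure) \<Rightarrow> (ennreal \<Rightarrow> 'w \<Rightarrow> 'a option) \<Rightarrow> 'a measure
    \<Rightarrow> (real \<Rightarrow> 'a \<Rightarrow> 'a \<Rightarrow> real) \<Rightarrow> bool"
where
  "transition_density P X m q \<longleftrightarrow>
     (\<forall>t>0. (\<lambda>(x, y). q t x y) \<in> borel_measurable (m \<Otimes>\<^sub>M m) \<and>
            (\<forall>x y. 0 \<le> q t x y) \<and>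
            (\<forall>x. trans_prob P X t x = density m (\<lambda>y. ennreal (q t x y))))"

definition measure_support :: "'a::topological_space measure \<Rightarrow> 'a set" where
  "measure_support m = {x. \<forall>U. open U \<and> x \<in> U \<longrightarrow> 0 < emeasure m U}"


section \<open>Assumption (A)\<close>

definition resolvent1 ::
  "('a::metric_space option \<Rightarrow> 'w measure) \<Rightarrow> (ennreal \<Rightarrow> 'w \<Rightarrow> 'a option)
    \<Rightarrow> ('a \<Rightarrow> ennreal) \<Rightarrow> 'a \<Rightarrow> ennreal"
where
  "resolvent1 P X g x =
     (\<integral>\<^sup>+t\<in>{0<..}. ennreal (exp (- t)) * (\<integral>\<^sup>+y. g y \<partial>trans_prob P X t x) \<partial>lborel)"

text \<open>The kernels \<open>R\<^sub>1\<close> and \<open>R\<^sub>1\<^sub>,\<^sub>\<delta>\<close> take values in \<open>[0, \<infinity>]\<close>; they may be infinite on the diagonal.\<close>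

definition resolvent1_density :: "(real \<Rightarrow> 'a \<Rightarrow> 'a \<Rightarrow> real) \<Rightarrow> 'a \<Rightarrow> 'a \<Rightarrow> ennreal" where
  "resolvent1_density q x y = (\<integral>\<^sup>+t\<in>{0<..}. ennreal (exp (- t) * q t x y) \<partial>lborel)"

definition resolvent1_density_upto ::
  "(real \<Rightarrow> 'a \<Rightarrow> 'a \<Rightarrow> real) \<Rightarrow> real \<Rightarrow> 'a \<Rightarrow> 'a \<Rightarrow> ennreal"
where
  "resolvent1_density_upto q \<delta> x y = (\<integral>\<^sup>+t\<in>{0<..\<delta>}. ennreal (exp (- t) * q t x y) \<partial>lborel)"

text \<open>
  \<open>T\<^sub>t f\<close> is the \<open>m\<close>-class of \<open>x \<mapsto> \<integral> f(y) p\<^sub>t(x, dy)\<close> for \<open>f\<close> in \<open>L\<^sup>2(E; m)\<close>. Its norm from \<open>L\<^sup>1\<close> to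
  \<open>L\<^sup>\<infinity>\<close> is taken over the unit ball (for the \<open>L\<^sup>1\<close> norm) of the intersection of \<open>L\<^sup>1\<close> and \<open>L\<^sup>2\<close>.
\<close>

definition semigroup_op ::
  "('a::metric_space option \<Rightarrow> 'w measure) \<Rightarrow> (ennreal \<Rightarrow> 'w \<Rightarrow> 'a option)
    \<Rightarrow> real \<Rightarrow> ('a \<Rightarrow> real) \<Rightarrow> 'a \<Rightarrow> real"
where
  "semigroup_op P X t f x = (\<integral>y. f y \<partial>trans_prob P X t x)"

definition norm_L1_Linf :: "'a measure \<Rightarrow> (('a \<Rightarrow> real) \<Rightarrow> 'a \<Rightarrow> real) \<Rightarrow> ereal" where
  "norm_L1_Linf m T =
     (SUP f \<in> {f. integrable m f \<and> integrable m (\<lambda>x. (f x)\<^sup>2) \<and> (\<integral>x. \<bar>f x\<bar> \<partial>m) \<le> 1}.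
        esssup m (\<lambda>x. ereal \<bar>T f x\<bar>))"

definition assumption_A1 ::
  "('a::metric_space option \<Rightarrow> 'w measure) \<Rightarrow> (ennreal \<Rightarrow> 'w \<Rightarrow> 'a option) \<Rightarrow> bool"
where
  "assumption_A1 P X \<longleftrightarrow>
     (\<forall>\<epsilon>>0. \<exists>K. compact K \<and> (SUP x. resolvent1 P X (indicator (- K)) x) \<le> ennreal \<epsilon>)"

definition assumption_A2 ::
  "('a::metric_space option \<Rightarrow> 'w measure) \<Rightarrow> (ennreal \<Rightarrow> 'w \<Rightarrow> 'a option) \<Rightarrow> 'a measure
    \<Rightarrow> (real \<Rightarrow> 'a \<Rightarrow> 'a \<Rightarrow> real) \<Rightarrow> bool"
where
  "assumption_A2 P X m q \<longleftrightarrow>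
     (\<forall>t>0. \<forall>x. absolutely_continuous m (trans_prob P X t x)) \<and>
     transition_density P X m q \<and>
     (\<forall>t>0. continuous_on UNIV (\<lambda>(x, y). q t x y) \<and> bounded (range (\<lambda>(x, y). q t x y)))"

definition assumption_A3 :: "'a measure \<Rightarrow> (real \<Rightarrow> 'a \<Rightarrow> 'a \<Rightarrow> real) \<Rightarrow> bool" where
  "assumption_A3 m q \<longleftrightarrow>
     (\<exists>\<rho>>0. \<exists>t\<^sub>0>0. \<exists>C>0. \<forall>t\<in>{0<..t\<^sub>0}.
        ennreal (inverse C * t powr (- \<rho> / 2)) \<le> (\<integral>\<^sup>+x. ennreal (q t x x) \<partial>m) \<and>
        (\<integral>\<^sup>+x. ennreal (q t x x) \<partial>m) \<le> ennreal (C * t powr (- \<rho> / 2)))"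

definition assumption_A4 ::
  "('a::metric_space option \<Rightarrow> 'w measure) \<Rightarrow> (ennreal \<Rightarrow> 'w \<Rightarrow> 'a option) \<Rightarrow> 'a measure
    \<Rightarrow> nat \<Rightarrow> bool"
where
  "assumption_A4 P X m p \<longleftrightarrow>
     (\<exists>\<mu>\<in>{2<..<2 * real p / (real p - 1)}. \<exists>C>0. \<exists>t\<^sub>0>0. \<forall>t\<in>{0<..t\<^sub>0}.
        norm_L1_Linf m (semigroup_op P X t) \<le> ereal (C * t powr (- \<mu> / 2)))"

definition assumption_A5 :: "'a measure \<Rightarrow> (real \<Rightarrow> 'a \<Rightarrow> 'a \<Rightarrow> real) \<Rightarrow> nat \<Rightarrow> bool" where
  "assumption_A5 m q p \<longleftrightarrow>
     (SUP x. \<integral>\<^sup>+y. resolvent1_density q x y ^ p \<partial>m) < \<infinity> \<and>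
     ((\<lambda>\<delta>. SUP x. \<integral>\<^sup>+y. resolvent1_density_upto q \<delta> x y ^ p \<partial>m) \<longlongrightarrow> 0) (at_right 0)"

text \<open>
  The density \<open>q\<close> is an argument because (A3) and (A5) depend on its values on null sets. By (A2)
  it is the continuous version, which is unique when \<open>m\<close> has full support.
\<close>

definition assumption_A ::
  "('a::metric_space option \<Rightarrow> 'w measure) \<Rightarrow> (ennreal \<Rightarrow> 'w \<Rightarrow> 'a option) \<Rightarrow> 'a measure
    \<Rightarrow> (real \<Rightarrow> 'a \<Rightarrow> 'a \<Rightarrow> real) \<Rightarrow> nat \<Rightarrow> bool"
where
  "assumption_A P X m q p \<longleftrightarrow>
     assumption_A1 P X \<and> assumption_A2 P X m q \<and> assumption_A3 m q \<and>
     assumption_A4 P X m p \<and> assumption_A5 m q p"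

end

theory Submission
  imports Defs
begin

text \<open>
  Put \<open>\<alpha> = d\<^sub>f / d\<^sub>w\<close>, so that \<open>q t x y \<le> c * t powr - \<alpha>\<close> for \<open>t \<le> 1\<close>, and
  \<open>d\<^sub>f - p * (d\<^sub>f - d\<^sub>w) > 0\<close> says \<open>(p - 1) * \<alpha> < p\<close>. The Markov property and continuity of \<open>q t x\<close> give the
  Chapman-Kolmogorov identity at every point, hence \<open>q t \<le> c * s powr - \<alpha>\<close> for \<open>t \<ge> s\<close>. Right continuity of
  the paths turns symmetry of the operators into symmetry of \<open>q\<close> at every point, and then dominated
  convergence in \<open>q (2 * s) x z = (\<integral>y. q s y x * q s y z \<partial>m)\<close> gives joint continuity (A2). For (A1), the time
  integral is split at a small time, and after that time the density is bounded and the measure is inner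
  regular. (A3) and (A4) are immediate. For (A5), the \<open>p\<close>-th power of \<open>q t x\<close> has integral at most
  \<open>(c * t powr - \<alpha>) ^ (p - 1)\<close>, and a weighted Hoelder inequality in time reduces the claim to the
  integrability of a power of \<open>t\<close> at \<open>0\<close>.
\<close>

section \<open>Transition probabilities of a Hunt process\<close>

lemma space_cemetery_borel [simp]: "space cemetery_borel = UNIV"
  by (simp add: cemetery_borel_def)

text \<open>\<open>Some\<close> is an open embedding. Being injective, it carries unions to unions
  and complements to complements inside the open set \<open>range Some\<close>, so induction over
  the generated sigma-algebra goes through.\<close>

lemma Some_image_in_cemetery_borel:
  fixes B :: "'a::topological_space set"
  assumes "B \<in> sets borel"
  shows "Some ` B \<in> sets cemetery_borel"
proof -
  have opn: "Some ` U \<in> sets cemetery_borel" if "open U" for U :: "'a set"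
    unfolding cemetery_borel_def using that
    by (intro in_measure_of) (auto simp: openin_Alexandroff_compactification)
  from assms have "B \<in> sigma_sets UNIV {S. open S}"
    by (simp add: borel_def)
  then show ?thesis
  proof induction
    case (Basic a)
    then show ?case using opn by auto
  next
    case Empty
    then show ?case by simp
  next
    case (Compl a)
    have "Some ` (UNIV - a) = Some ` UNIV - Some ` a"
      by auto
    then show ?case using Compl opn[of UNIV] by auto
  next
    case (Union a)
    have "Some ` (\<Union>i. a i) = (\<Union>i. Some ` a i)"
      by auto
    then show ?case using Union by auto
  qed
qed

lemma measurable_Some_cemetery [measurable]:
  "Some \<in> measurable (borel :: 'a::t2_space measure) cemetery_borel"
  unfolding cemetery_borel_def
proof (rule measurable_measure_of)
  fix V :: "'a option set"
  assume "V \<in> {U. openin cemetery_topology U}"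
  then consider U where "open U" "V = Some ` U"
    | C where "closed C" "V = insert None (Some ` (- C))"
    by (auto simp: openin_Alexandroff_compactification Compl_eq_Diff_UNIV)
  then have "open (Some -` V)"
  proof cases
    case 1
    then have "Some -` V = U" by auto
    with 1 show ?thesis by simp
  next
    case 2
    then have "Some -` V = - C" by auto
    with 2 show ?thesis by auto
  qed
  then show "Some -` V \<inter> space borel \<in> sets borel"
    by simp
qed auto

text \<open>Makes it possible to compose a function on the state space, extended by a constant at
  the cemetery, with \<open>X t\<close>. The singleton \<open>{None}\<close> is measurable as the
  complement of \<open>range Some\<close>.\<close>

lemma measurable_case_option_cemetery:
  fixes f :: "'a::topological_space \<Rightarrow> 'b"
  assumes f: "f \<in> measurable borel N" and c: "c \<in> space N"
  shows "case_option c f \<in> measurable cemetery_borel N"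
proof (rule measurableI)
  fix x show "case_option c f x \<in> space N"
    using c measurable_space[OF f] by (cases x) auto
next
  fix A assume A: "A \<in> sets N"
  have 1: "Some ` (f -` A) \<in> sets cemetery_borel"
    using measurable_sets[OF f A] by (intro Some_image_in_cemetery_borel) simp
  have 2: "{None :: 'a option} \<in> sets cemetery_borel"
  proof -
    have "x \<in> space cemetery_borel - range Some \<longleftrightarrow> x \<in> {None}" for x :: "'a option"
      by (cases x) auto
    then have "space cemetery_borel - range Some = {None :: 'a option}"
      by blast
    then show ?thesis
      using sets.compl_sets[OF Some_image_in_cemetery_borel[of "UNIV :: 'a set"]] by simp
  qed
  have "case_option c f -` A \<inter> space cemetery_borel = Some ` (f -` A) \<union> (if c \<in> A then {None} else {})"
    by (auto split: option.splits)
  with 1 2 show "case_option c f -` A \<inter> space cemetery_borel \<in> sets cemetery_borel"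
    using sets.Un by (auto simp del: Un_insert_right)
qed

text \<open>Every neighbourhood of \<open>x\<close> is mapped by \<open>Some\<close> to a
  neighbourhood of \<open>Some x\<close> that avoids the cemetery, so the extension behaves like
  \<open>f\<close> along \<open>G\<close> even though it need not be continuous at
  \<open>None\<close>.\<close>

lemma limitin_cemetery_case_option:
  fixes f :: "'a::t2_space \<Rightarrow> 'b::topological_space"
  assumes "limitin cemetery_topology u (Some x) G" and "isCont f x"
  shows "((\<lambda>s. case_option c f (u s)) \<longlongrightarrow> f x) G"
proof (rule topological_tendstoI)
  fix S assume S: "open S" "f x \<in> S"
  obtain U where U: "open U" "x \<in> U" "\<And>y. y \<in> U \<Longrightarrow> f y \<in> S"
    using assms(2)[unfolded continuous_at_open] S by metis
  have "openin cemetery_topology (Some ` U)"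
    using U by (auto simp: openin_Alexandroff_compactification)
  then have "eventually (\<lambda>s. u s \<in> Some ` U) G"
    using assms(1) U unfolding limitin_def by blast
  then show "eventually (\<lambda>s. case_option c f (u s) \<in> S) G"
    by eventually_elim (use U in auto)
qed

section \<open>Transition kernels as pushforwards and their Markov identity\<close>

context markov_process
begin

lemma space_P: "space (P x) = \<Omega>"
  using sets_eq_imp_space_eq[OF sets_P] space_F by auto

lemma X_measurable: "X t \<in> measurable (P x) cemetery_borel"
proof -
  have "sets (F t) \<subseteq> sets (P x)"
    using sets_F_mono[of t \<infinity>] sets_P by auto
  then have "measurable (F t) cemetery_borel \<subseteq> measurable (P x) cemetery_borel"
    by (intro measurable_mono) (auto simp: space_F space_P)
  with adapted show ?thesis by blast
qed

lemma alive_sets: "{\<omega>. X t \<omega> \<noteq> None} \<inter> space (P x) \<in> sets (P x)"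
proof -
  have "{\<omega>. X t \<omega> \<noteq> None} \<inter> space (P x) = X t -` (Some ` UNIV) \<inter> space (P x)"
    by (auto; metis not_None_eq rangeI)
  then show ?thesis
    using measurable_sets[OF X_measurable Some_image_in_cemetery_borel[of UNIV]] by simp
qed

lemma the_X_measurable:
  "(\<lambda>\<omega>. the (X t \<omega>)) \<in> measurable (restrict_space (P x) {\<omega>. X t \<omega> \<noteq> None}) borel"
proof -
  have "(\<lambda>\<omega>. case_option undefined id (X t \<omega>)) \<in> measurable (P x) borel"
    by (rule measurable_compose[OF X_measurable measurable_case_option_cemetery]) auto
  then have "(\<lambda>\<omega>. case_option undefined id (X t \<omega>))
      \<in> measurable (restrict_space (P x) {\<omega>. X t \<omega> \<noteq> None}) borel"
    by (rule measurable_restrict_space1)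
  then show ?thesis
    by (rule measurable_cong[THEN iffD1, rotated]) (auto simp: space_restrict_space)
qed

text \<open>\<open>trans_prob\<close> is given by a formula whose countable additivity is not
  evident. Recognizing it as the law of the position on the event of being alive makes it a genuine
  measure and gives change of variables.\<close>

lemma trans_prob_eq_distr:
  "trans_prob P X t x =
     distr (restrict_space (P (Some x)) {\<omega>. X (ennreal t) \<omega> \<noteq> None}) borel (\<lambda>\<omega>. the (X (ennreal t) \<omega>))"
    (is "_ = ?D")
proof -
  have "trans_prob P X t x = measure_of (space ?D) (sets ?D) (emeasure ?D)"
    unfolding trans_prob_def
  proof (simp only: space_distr sets_distr space_borel, rule measure_of_eq)
    fix B :: "'a set" assume "B \<in> sigma_sets UNIV (sets borel)"
    then have B: "B \<in> sets borel"
      using sets.sigma_sets_eq[of "borel :: 'a measure"] by (simp only: space_borel)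
    show "emeasure (P (Some x)) {\<omega> \<in> space (P (Some x)). X (ennreal t) \<omega> \<in> Some ` B} = emeasure ?D B"
      by (subst emeasure_distr[OF the_X_measurable B], subst emeasure_restrict_space[OF alive_sets])
         (auto simp: space_restrict_space intro!: arg_cong[where f="emeasure (P (Some x))"])
  qed auto
  then show ?thesis
    using measure_of_of_measure by metis
qed

lemma sets_trans_prob: "sets (trans_prob P X t x) = sets borel"
  by (simp add: trans_prob_eq_distr)

lemma emeasure_trans_prob:
  assumes "B \<in> sets borel"
  shows "emeasure (trans_prob P X t x) B = emeasure (P (Some x)) {\<omega> \<in> \<Omega>. X (ennreal t) \<omega> \<in> Some ` B}"
  unfolding trans_prob_eq_distr
  by (subst emeasure_distr[OF the_X_measurable assms], subst emeasure_restrict_space[OF alive_sets])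
     (auto simp: space_restrict_space space_P intro!: arg_cong[where f="emeasure (P (Some x))"])

lemma emeasure_trans_prob_le_1: "emeasure (trans_prob P X t x) B \<le> 1"
proof (cases "B \<in> sets borel")
  case True
  then show ?thesis
    using prob_space.emeasure_le_1[OF prob_space_P] by (simp add: emeasure_trans_prob)
next
  case False
  then show ?thesis
    by (simp add: emeasure_notin_sets sets_trans_prob)
qed

text \<open>The kernel drops the mass at the cemetery, which corresponds to the default value 0 at
  \<open>None\<close>.\<close>

lemma integral_trans_prob:
  fixes f :: "'a \<Rightarrow> real"
  assumes "f \<in> borel_measurable borel"
  shows "(\<integral>y. f y \<partial>trans_prob P X t x) = (\<integral>\<omega>. case_option 0 f (X (ennreal t) \<omega>) \<partial>P (Some x))"
  unfolding trans_prob_eq_distr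
  by (subst integral_distr[OF the_X_measurable assms], subst integral_restrict_space[OF alive_sets])
     (auto intro!: Bochner_Integration.integral_cong split: option.splits)

lemma measure_trans_prob_measurable:
  assumes "C \<in> sets borel"
  shows "(\<lambda>y. measure (trans_prob P X t y) C) \<in> borel_measurable borel"
proof -
  have "(\<lambda>y. measure (P (Some y)) {\<omega> \<in> \<Omega>. X (ennreal t) \<omega> \<in> Some ` C}) \<in> borel_measurable borel"
    by (rule measurable_compose[OF measurable_Some_cemetery
            measurable_P[OF Some_image_in_cemetery_borel[OF assms]]])
  then show ?thesis
    by (simp add: measure_def emeasure_trans_prob[OF assms])
qed

text \<open>A conditional expectation has the same integral as the function it conditions, so taking
  expectations in the Markov property leaves the kernel at time \<open>s\<close> averaged over the
  position at time \<open>t\<close>.\<close>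

lemma measure_trans_prob_Markov:
  assumes "0 \<le> t" "0 \<le> s" and C: "C \<in> sets borel"
  shows "measure (trans_prob P X (t + s) x) C
           = (\<integral>y. measure (trans_prob P X s y) C \<partial>trans_prob P X t x)"
proof -
  let ?P = "P (Some x)" and ?C = "{\<omega> \<in> \<Omega>. X (ennreal s) \<omega> \<in> Some ` C}"
    and ?A = "{\<omega> \<in> \<Omega>. X (ennreal t + ennreal s) \<omega> \<in> Some ` C}"
  interpret prob_space ?P by (rule prob_space_P)
  have "finite_measure_subalgebra ?P (F (ennreal t))"
    using sets_F_mono[of "ennreal t" \<infinity>]
    by unfold_locales (auto simp: subalgebra_def space_F space_P sets_P)
  then interpret finite_measure_subalgebra ?P "F (ennreal t)" .
  have A: "?A \<in> sets ?P"
    using measurable_sets[OF X_measurable Some_image_in_cemetery_borel[OF C]]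
    by (auto simp: space_P vimage_def Int_def conj_commute)
  have g: "(\<lambda>y. measure (trans_prob P X s y) C) = (\<lambda>y. measure (P (Some y)) ?C)"
    by (auto simp: measure_def emeasure_trans_prob[OF C])
  have meas: "(\<lambda>y. measure (P (Some y)) ?C) \<in> borel_measurable borel"
    using measure_trans_prob_measurable[OF C, of s] unfolding g .
  \<comment> \<open>Started at the cemetery, the process is almost surely still there, so dead paths
    contribute 0. The integrand is therefore an extension by 0, the form that
    \<open>integral_trans_prob\<close> handles.\<close>
  have dead: "measure (P None) ?C = 0"
  proof -
    interpret N: prob_space "P None" by (rule prob_space_P)
    have "AE \<omega> in P None. \<omega> \<notin> ?C"
      using cemetery_trap[of "ennreal s"] by eventually_elim auto
    moreover have "?C \<in> sets (P None)"
      using measurable_sets[OF X_measurable Some_image_in_cemetery_borel[OF C]]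
      by (auto simp: space_P vimage_def Int_def conj_commute)
    ultimately show ?thesis
      by (simp add: N.prob_eq_0)
  qed
  have ts: "ennreal (t + s) = ennreal t + ennreal s"
    using assms by (simp add: ennreal_plus)
  have "measure (trans_prob P X (t + s) x) C = measure ?P ?A"
    by (simp add: measure_def emeasure_trans_prob[OF C] ts)
  also have "\<dots> = (\<integral>\<omega>. indicat_real ?A \<omega> \<partial>?P)"
    using A by simp
  also have "\<dots> = (\<integral>\<omega>. real_cond_exp ?P (F (ennreal t)) (indicat_real ?A) \<omega> \<partial>?P)"
    using A by (intro real_cond_exp_int(2)[symmetric]) (simp add: integrable_indicator_iff less_top[symmetric])
  also have "\<dots> = (\<integral>\<omega>. measure (P (X (ennreal t) \<omega>)) ?C \<partial>?P)"
  proof (rule integral_cong_AE)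
    show "(\<lambda>\<omega>. measure (P (X (ennreal t) \<omega>)) ?C) \<in> borel_measurable ?P"
      by (rule measurable_compose[OF X_measurable measurable_P[OF Some_image_in_cemetery_borel[OF C]]])
    show "AE \<omega> in ?P. real_cond_exp ?P (F (ennreal t)) (indicat_real ?A) \<omega>
              = measure (P (X (ennreal t) \<omega>)) ?C"
      using markov[where x="Some x", OF _ _ Some_image_in_cemetery_borel[OF C], of "ennreal s" "ennreal t"] by simp
  qed (rule borel_measurable_cond_exp2)
  also have "\<dots> = (\<integral>\<omega>. case_option 0 (\<lambda>y. measure (P (Some y)) ?C) (X (ennreal t) \<omega>) \<partial>?P)"
    using dead by (intro Bochner_Integration.integral_cong) (auto split: option.splits)
  also have "\<dots> = (\<integral>y. measure (trans_prob P X s y) C \<partial>trans_prob P X t x)"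
    unfolding g by (rule integral_trans_prob[OF meas, symmetric])
  finally show ?thesis .
qed

lemma finite_measure_trans_prob: "finite_measure (trans_prob P X t x)"
  by (rule finite_measureI) (metis emeasure_trans_prob_le_1 ennreal_one_neq_top infinity_ennreal_def top_unique)

lemma emeasure_trans_prob_Markov:
  assumes "0 \<le> t" "0 \<le> s" and C: "C \<in> sets borel"
  shows "emeasure (trans_prob P X (t + s) x) C
           = (\<integral>\<^sup>+y. emeasure (trans_prob P X s y) C \<partial>trans_prob P X t x)"
proof -
  note em = finite_measure.emeasure_eq_measure[OF finite_measure_trans_prob]
  have "emeasure (trans_prob P X s y) C \<le> 1" for y
    by (rule emeasure_trans_prob_le_1)
  then have le: "measure (trans_prob P X s y) C \<le> 1" for y
    by (simp add: em)
  have "(\<lambda>y. measure (trans_prob P X s y) C) \<in> borel_measurable (trans_prob P X t x)"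
    using measure_trans_prob_measurable[OF C, of s] measurable_cong_sets[OF sets_trans_prob refl] by blast
  then have "integrable (trans_prob P X t x) (\<lambda>y. measure (trans_prob P X s y) C)"
    by (intro finite_measure.integrable_const_bound[OF finite_measure_trans_prob, where B=1])
       (auto simp: le)
  then show ?thesis
    unfolding em measure_trans_prob_Markov[OF assms]
    by (intro nn_integral_eq_integral[symmetric]) auto
qed

end

section \<open>Right continuity in time and the initial condition\<close>

context hunt_process
begin

text \<open>Dominated convergence along paths. The extension by 0 need not be continuous at
  \<open>None\<close>, so there are two cases: a path alive at \<open>t\<close> is handled by right
  continuity, a dead one by absorption after its lifetime.\<close>

lemma integral_case_option_right_continuous:
  fixes f :: "'a \<Rightarrow> real"
  assumes f: "continuous_on UNIV f" "\<And>x. \<bar>f x\<bar> \<le> b"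
    and "0 \<le> t" and e: "\<And>n. 0 < e n" "e \<longlonglongrightarrow> 0"
  shows "(\<lambda>n. \<integral>\<omega>. case_option 0 f (X (ennreal (t + e n)) \<omega>) \<partial>P x)
           \<longlonglongrightarrow> (\<integral>\<omega>. case_option 0 f (X (ennreal t) \<omega>) \<partial>P x)"
proof (rule integral_dominated_convergence)
  interpret prob_space "P x" by (rule prob_space_P)
  have [measurable]: "f \<in> borel_measurable borel"
    using f(1) by (rule borel_measurable_continuous_onI)
  have meas: "(\<lambda>\<omega>. case_option 0 f (X s \<omega>)) \<in> borel_measurable (P x)" for s
    by (rule measurable_compose[OF X_measurable measurable_case_option_cemetery]) auto
  show "(\<lambda>\<omega>. case_option 0 f (X (ennreal t) \<omega>)) \<in> borel_measurable (P x)"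
    "\<And>n. (\<lambda>\<omega>. case_option 0 f (X (ennreal (t + e n)) \<omega>)) \<in> borel_measurable (P x)"
    by (rule meas)+
  show "integrable (P x) (\<lambda>_. b)" by simp
  have "0 \<le> b" using f(2)[of undefined] by linarith
  then show "AE \<omega> in P x. norm (case_option 0 f (X (ennreal (t + e n)) \<omega>)) \<le> b" for n
    using f(2) by (auto split: option.splits)
  have "(\<lambda>n. t + e n) \<longlonglongrightarrow> t + 0"
    by (intro tendsto_intros e)
  then have lim: "filterlim (\<lambda>n. ennreal (t + e n)) (at_right (ennreal t)) sequentially"
    using e(1) \<open>0 \<le> t\<close>
    by (auto simp: filterlim_at less_imp_neq[symmetric] ennreal_less_iff intro!: always_eventually tendsto_ennrealI)
  have "(\<lambda>n. case_option 0 f (X (ennreal (t + e n)) \<omega>)) \<longlonglongrightarrow> case_option 0 f (X (ennreal t) \<omega>)"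
    if "\<omega> \<in> \<Omega>" for \<omega>
  proof (cases "X (ennreal t) \<omega>")
    case None
    then have "lifetime X \<omega> \<le> ennreal t"
      by (auto simp: lifetime_def intro: Inf_lower)
    then have "lifetime X \<omega> \<le> ennreal (t + e n)" for n
      using e(1)[of n] by (auto elim!: order_trans intro!: ennreal_leI)
    then have "X (ennreal (t + e n)) \<omega> = None" for n
      using X_after_lifetime that by blast
    with None show ?thesis by simp
  next
    case (Some y)
    have "isCont f y"
      using f(1) by (simp add: continuous_on_eq_continuous_at)
    moreover have "limitin cemetery_topology (\<lambda>s. X s \<omega>) (Some y) (at_right (ennreal t))"
      using right_continuous_paths[of "ennreal t" \<omega>] that Some by simp
    ultimately show ?thesis
      unfolding Some option.case
      by (intro filterlim_compose[OF _ lim] limitin_cemetery_case_option)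
  qed
  then show "AE \<omega> in P x. (\<lambda>n. case_option 0 f (X (ennreal (t + e n)) \<omega>)) \<longlonglongrightarrow> case_option 0 f (X (ennreal t) \<omega>)"
    by (auto simp: space_P)
qed

lemma integral_trans_prob_right_continuous:
  fixes f :: "'a \<Rightarrow> real"
  assumes f: "continuous_on UNIV f" "\<And>x. \<bar>f x\<bar> \<le> b"
    and "0 \<le> t" and e: "\<And>n. 0 < e n" "e \<longlonglongrightarrow> 0"
  shows "(\<lambda>n. \<integral>y. f y \<partial>trans_prob P X (t + e n) x) \<longlonglongrightarrow> (\<integral>y. f y \<partial>trans_prob P X t x)"
  using integral_case_option_right_continuous[OF assms, of "Some x"]
    integral_trans_prob[OF borel_measurable_continuous_onI[OF f(1)]] by simp

lemma integral_trans_prob_0: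
  fixes f :: "'a \<Rightarrow> real"
  assumes [measurable]: "f \<in> borel_measurable borel"
  shows "(\<integral>y. f y \<partial>trans_prob P X 0 x) = f x"
proof -
  interpret prob_space "P (Some x)" by (rule prob_space_P)
  have [measurable]: "(\<lambda>\<omega>. case_option 0 f (X s \<omega>)) \<in> borel_measurable (P (Some x))" for s
    by (rule measurable_compose[OF X_measurable measurable_case_option_cemetery]) auto
  have "(\<integral>y. f y \<partial>trans_prob P X 0 x) = (\<integral>\<omega>. case_option 0 f (X 0 \<omega>) \<partial>P (Some x))"
    using integral_trans_prob[OF assms, of 0] by simp
  also have "\<dots> = (\<integral>\<omega>. f x \<partial>P (Some x))"
    using normal[of "Some x"] by (intro integral_cong_AE) auto
  finally show ?thesis by (simp add: prob_space)
qed

end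

section \<open>Integral inequalities\<close>

text \<open>The set where two continuous functions differ is open; being null, it is empty by full
  support.\<close>

lemma continuous_AE_eq:
  fixes f g :: "'a::topological_space \<Rightarrow> real"
  assumes "continuous_on UNIV f" "continuous_on UNIV g"
    and "AE x in m. f x = g x" and "sets m = sets borel" and "measure_support m = UNIV"
  shows "f x = g x"
proof (rule ccontr)
  assume "f x \<noteq> g x"
  let ?U = "{x. f x \<noteq> g x}"
  have U: "open ?U"
    using assms(1,2) by (intro open_Collect_neq) auto
  have "space m = UNIV"
    using sets_eq_imp_space_eq[OF assms(4)] by simp
  then have "emeasure m ?U = 0"
    using assms(3,4) U by (subst (asm) AE_iff_measurable[of ?U]) auto
  moreover have "0 < emeasure m ?U"
    using assms(5) U \<open>f x \<noteq> g x\<close> by (auto simp: measure_support_def)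
  ultimately show False by simp
qed

text \<open>Sequences suffice because the parameter space is metric, and then dominated convergence
  applies.\<close>

lemma continuous_on_integral_dominated:
  fixes f :: "'b::metric_space \<Rightarrow> 'a \<Rightarrow> real"
  assumes "\<And>y. continuous_on UNIV (\<lambda>z. f z y)" "\<And>z. f z \<in> borel_measurable M"
    and "integrable M w" "\<And>z y. \<bar>f z y\<bar> \<le> w y"
  shows "continuous_on UNIV (\<lambda>z. \<integral>y. f z y \<partial>M)"
  unfolding continuous_on_sequentially comp_def
proof (intro allI ballI impI)
  fix u and a :: 'b assume "(\<forall>n. u n \<in> UNIV) \<and> u \<longlonglongrightarrow> a"
  then have "u \<longlonglongrightarrow> a" by simp
  then have "(\<lambda>n. f (u n) y) \<longlonglongrightarrow> f a y" for y
    using assms(1) continuous_on_tendsto_compose[of UNIV "\<lambda>z. f z y" u a] by auto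
  then show "(\<lambda>n. \<integral>y. f (u n) y \<partial>M) \<longlonglongrightarrow> (\<integral>y. f a y \<partial>M)"
    using assms(2-4) by (intro integral_dominated_convergence[where w=w]) auto
qed

text \<open>This is \<open>(b - a) * (b ^ n - a ^ n) \<ge> 0\<close>, arranged so that no
  subtraction in \<open>ennreal\<close> occurs; the proof writes the larger number as the smaller
  plus \<open>d\<close>.\<close>

lemma ennreal_rearrangement:
  fixes a b :: ennreal
  shows "a * b ^ n + a ^ n * b \<le> a ^ Suc n + b ^ Suc n"
proof -
  have *: "a * b ^ n + a ^ n * b \<le> a ^ Suc n + b ^ Suc n" if ab: "a \<le> b" for a b :: ennreal
  proof -
    obtain d where d: "b = a + d" using ab by (auto simp: le_iff_add)
    have "a * b ^ n + a ^ n * b = a * b ^ n + a ^ Suc n + a ^ n * d"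
      by (simp add: d algebra_simps)
    also have "\<dots> \<le> a * b ^ n + a ^ Suc n + b ^ n * d"
      by (intro add_left_mono mult_right_mono power_mono ab) auto
    also have "\<dots> = a ^ Suc n + (a + d) * b ^ n"
      by (simp only: algebra_simps)
    finally show ?thesis by (simp add: d)
  qed
  show ?thesis
    using *[of a b] *[of b a] by (cases "a \<le> b") (auto simp: mult.commute add.commute)
qed

text \<open>Induction on the exponent. Integrating the rearrangement inequality over pairs of points
  gives Chebyshev's inequality for the comonotone functions \<open>h\<close> and
  \<open>h ^ Suc n\<close>, which raises the exponent by one.\<close>

lemma nn_integral_power_le:
  assumes [measurable]: "h \<in> borel_measurable M"
  shows "(\<integral>\<^sup>+x. h x \<partial>M) ^ Suc n \<le> emeasure M (space M) ^ n * (\<integral>\<^sup>+x. h x ^ Suc n \<partial>M)"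
proof (induction n)
  case 0
  then show ?case by simp
next
  case (Suc n)
  let ?I = "\<lambda>k. \<integral>\<^sup>+x. h x ^ k \<partial>M" and ?W = "emeasure M (space M)"
  \<comment> \<open>Both cross terms have the same double integral, whence the factor 2, cancelled
    below.\<close>
  have "2 * (?I 1 * ?I (Suc n)) = (\<integral>\<^sup>+x. (\<integral>\<^sup>+y. h x * h y ^ Suc n + h x ^ Suc n * h y \<partial>M) \<partial>M)"
    by (simp add: nn_integral_add nn_integral_cmult nn_integral_multc mult_2 mult.commute)
  also have "\<dots> \<le> (\<integral>\<^sup>+x. (\<integral>\<^sup>+y. h x ^ Suc (Suc n) + h y ^ Suc (Suc n) \<partial>M) \<partial>M)"
    by (intro nn_integral_mono ennreal_rearrangement)
  also have "\<dots> = 2 * (?W * ?I (Suc (Suc n)))"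
    by (simp add: nn_integral_add nn_integral_cmult nn_integral_multc mult_2 mult.commute)
  finally have "?I 1 * ?I (Suc n) \<le> ?W * ?I (Suc (Suc n))"
    by (subst (asm) ennreal_mult_le_mult_iff) auto
  then have step: "(\<integral>\<^sup>+x. h x \<partial>M) * ?I (Suc n) \<le> ?W * ?I (Suc (Suc n))"
    by simp
  have "(\<integral>\<^sup>+x. h x \<partial>M) ^ Suc (Suc n) \<le> (\<integral>\<^sup>+x. h x \<partial>M) * (?W ^ n * ?I (Suc n))"
    using mult_left_mono[OF Suc.IH, of "\<integral>\<^sup>+x. h x \<partial>M"] by simp
  also have "\<dots> = ?W ^ n * ((\<integral>\<^sup>+x. h x \<partial>M) * ?I (Suc n))"
    by (simp only: ac_simps)
  also have "\<dots> \<le> ?W ^ n * (?W * ?I (Suc (Suc n)))"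
    by (intro mult_left_mono step) auto
  finally show ?case
    by (simp only: power_Suc ac_simps)
qed

lemma nn_integral_powr_from_0:
  fixes a d :: real
  assumes "-1 < a" "0 \<le> d"
  shows "(\<integral>\<^sup>+t\<in>{0<..d}. ennreal (t powr a) \<partial>lborel) = ennreal (d powr (a + 1) / (a + 1))"
proof -
  \<comment> \<open>Adding the endpoint is harmless since \<open>0 powr a\<close> is 0.\<close>
  have "(\<integral>\<^sup>+t\<in>{0<..d}. ennreal (t powr a) \<partial>lborel) = (\<integral>\<^sup>+t. ennreal (t powr a) * indicator {0..d} t \<partial>lborel)"
    by (intro nn_integral_cong) (auto simp: indicator_def)
  also have "\<dots> = ennreal (d powr (a + 1) / (a + 1))"
    by (rule nn_integral_has_integral_lebesgue'[OF _ has_integral_powr_from_0]) (use assms in auto)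
  finally show ?thesis .
qed

text \<open>Jensen's inequality for the finite measure \<open>t powr - b\<close> on \<open>{0<..d}\<close>.\<close>

lemma nn_integral_interval_power_le:
  fixes u :: "real \<Rightarrow> real"
  assumes [measurable]: "(\<lambda>t. indicator {0<..} t * u t) \<in> borel_measurable borel"
    and u: "\<And>t. 0 < t \<Longrightarrow> 0 \<le> u t" and b: "b < 1" and d: "0 \<le> d"
  shows "(\<integral>\<^sup>+t\<in>{0<..d}. ennreal (u t) \<partial>lborel) ^ Suc n
           \<le> ennreal (d powr (1 - b) / (1 - b)) ^ n
             * (\<integral>\<^sup>+t\<in>{0<..d}. ennreal (t powr (b * n) * u t ^ Suc n) \<partial>lborel)"
proof -
  let ?u = "\<lambda>t. indicator {0<..} t * u t"
  define M where "M = density lborel (\<lambda>t. ennreal (t powr - b) * indicator {0<..d} t)"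
  \<comment> \<open>The factor \<open>t powr b\<close> cancels the weight of \<open>M\<close>, so
    \<open>h\<close> integrates to the integral of \<open>u\<close>. In \<open>h ^ Suc n\<close> one
    such factor cancels and \<open>t powr (b * n)\<close> remains.\<close>
  define h where "h t = ennreal (?u t * t powr b)" for t
  have hm [measurable]: "h \<in> borel_measurable borel"
    unfolding h_def by measurable
  have "emeasure M (space M) = (\<integral>\<^sup>+t\<in>{0<..d}. ennreal (t powr - b) \<partial>lborel)"
    by (simp add: M_def emeasure_density)
  also have "\<dots> = ennreal (d powr (1 - b) / (1 - b))"
    using b d by (subst nn_integral_powr_from_0) auto
  finally have W: "emeasure M (space M) = ennreal (d powr (1 - b) / (1 - b))" .
  have "(\<integral>\<^sup>+t. h t \<partial>M) = (\<integral>\<^sup>+t. ennreal (t powr - b) * indicator {0<..d} t * h t \<partial>lborel)"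
    unfolding M_def by (intro nn_integral_density) auto
  also have "\<dots> = (\<integral>\<^sup>+t\<in>{0<..d}. ennreal (u t) \<partial>lborel)"
    by (intro nn_integral_cong)
       (auto simp: indicator_def h_def ennreal_mult'[symmetric] powr_minus field_simps)
  finally have 1: "(\<integral>\<^sup>+t. h t \<partial>M) = (\<integral>\<^sup>+t\<in>{0<..d}. ennreal (u t) \<partial>lborel)" .
  have pw: "t powr - b * (u t * t powr b) ^ Suc n = t powr (b * n) * u t ^ Suc n" if "0 < t" for t
  proof -
    have "(t powr b) ^ Suc n = t powr b * t powr (b * n)"
      using that by (simp add: powr_power mult.commute)
    then show ?thesis
      using that by (simp add: power_mult_distrib powr_minus field_simps)
  qed
  have "(\<integral>\<^sup>+t. h t ^ Suc n \<partial>M) = (\<integral>\<^sup>+t. ennreal (t powr - b) * indicator {0<..d} t * h t ^ Suc n \<partial>lborel)"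
    unfolding M_def by (intro nn_integral_density) auto
  also have "\<dots> = (\<integral>\<^sup>+t\<in>{0<..d}. ennreal (t powr (b * n) * u t ^ Suc n) \<partial>lborel)"
  proof (intro nn_integral_cong)
    fix t
    show "ennreal (t powr - b) * indicator {0<..d} t * h t ^ Suc n
        = ennreal (t powr (b * n) * u t ^ Suc n) * indicator {0<..d} t"
    proof (cases "t \<in> {0<..d}")
      case True
      then have "h t ^ Suc n = ennreal ((u t * t powr b) ^ Suc n)"
        using u by (simp add: h_def ennreal_power del: power_Suc)
      with True show ?thesis
        using pw[of t] by (simp add: ennreal_mult'[symmetric] del: power_Suc)
    qed simp
  qed
  finally have 2: "(\<integral>\<^sup>+t. h t ^ Suc n \<partial>M) = (\<integral>\<^sup>+t\<in>{0<..d}. ennreal (t powr (b * n) * u t ^ Suc n) \<partial>lborel)" .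
  have "h \<in> borel_measurable M"
    by (simp add: M_def)
  from nn_integral_power_le[OF this, of n] show ?thesis
    unfolding 1 2 W .
qed

text \<open>Local compactness and the Lindelof property give a countable cover by sets lying in
  compacts. Finite unions of these compacts increase to the whole space, and continuity from above
  of the finite measure makes the complements small.\<close>

lemma sigma_compact_approximation:
  fixes m :: "'a::{t2_space, second_countable_topology} measure"
  assumes "locally_compact_space (euclidean :: 'a topology)" "finite_measure m" "sets m = sets borel"
    and "0 < e"
  obtains K where "compact K" "measure m (- K) < e"
proof -
  interpret finite_measure m by fact
  have sp: "space m = UNIV"
    using sets_eq_imp_space_eq[OF assms(3)] by simp
  define \<F> where "\<F> = {U :: 'a set. open U \<and> (\<exists>K. compact K \<and> U \<subseteq> K)}"
  have "\<exists>U\<in>\<F>. x \<in> U" for x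
    using assms(1) unfolding locally_compact_space_def \<F>_def by simp metis
  then have cover: "\<Union>\<F> = UNIV" by blast
  obtain \<F>' where F': "\<F>' \<subseteq> \<F>" "countable \<F>'" "\<Union>\<F>' = \<Union>\<F>"
    using Lindelof[of \<F>] by (auto simp: \<F>_def)
  then have "\<F>' \<noteq> {}" using cover by auto
  then have rg: "range (from_nat_into \<F>') = \<F>'"
    using F'(2) by simp
  then have "\<forall>n. \<exists>K. compact K \<and> from_nat_into \<F>' n \<subseteq> K"
    using F'(1) by (auto simp: \<F>_def)
  then obtain K where K: "\<And>n. compact (K n)" "\<And>n. from_nat_into \<F>' n \<subseteq> K n"
    by metis
  define L where "L n = (\<Union>i\<le>n. K i)" for n :: nat
  have cL: "compact (L n)" for n
    unfolding L_def using K by (intro compact_UN) auto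
  have "(\<Inter>n. - L n) = {}"
  proof -
    have "\<exists>n. x \<in> L n" for x
    proof -
      obtain n where "x \<in> from_nat_into \<F>' n"
        using cover F'(3) rg by (metis UNIV_I UnionE imageE)
      then show ?thesis using K(2) unfolding L_def by blast
    qed
    then show ?thesis by blast
  qed
  moreover have "(\<lambda>n. measure m (- L n)) \<longlonglongrightarrow> measure m (\<Inter>n. - L n)"
    using cL by (intro finite_Lim_measure_decseq)
      (auto simp: assms(3) decseq_def L_def intro!: borel_open open_Compl compact_imp_closed compact_UN K)
  ultimately have "(\<lambda>n. measure m (- L n)) \<longlonglongrightarrow> 0" by simp
  from order_tendstoD(2)[OF this \<open>0 < e\<close>] obtain n where "measure m (- L n) < e"
    by (auto simp: eventually_sequentially)
  with cL that show ?thesis by blast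
qed

section \<open>Symmetric transition densities with an on-diagonal bound\<close>

text \<open>The interface between process and analysis: what the paths provide is recorded as
  properties of the kernel. Continuity is assumed in the second variable only, and symmetry only
  against test functions. \<open>q_initial\<close> and \<open>q_right_continuous\<close> encode
  right continuity of the paths at time 0 and at positive times.\<close>

locale bounded_density = finite_measure m
  for m :: "'a::{metric_space, second_countable_topology} measure" +
  fixes q :: "real \<Rightarrow> 'a \<Rightarrow> 'a \<Rightarrow> real" and c \<alpha> :: real
  assumes sets_m: "sets m = sets borel"
    and support: "measure_support m = UNIV"
    and q_measurable: "0 < t \<Longrightarrow> (\<lambda>(x, y). q t x y) \<in> borel_measurable (m \<Otimes>\<^sub>M m)"
    and q_nonneg: "0 < t \<Longrightarrow> 0 \<le> q t x y"
    and q_continuous: "0 < t \<Longrightarrow> continuous_on UNIV (q t x)"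
    and q_mass: "0 < t \<Longrightarrow> (\<integral>\<^sup>+y. ennreal (q t x y) \<partial>m) \<le> 1"
    and q_semigroup: "0 < t \<Longrightarrow> 0 < s \<Longrightarrow> C \<in> sets borel \<Longrightarrow>
          (\<integral>\<^sup>+z. ennreal (q (t + s) x z) * indicator C z \<partial>m)
            = (\<integral>\<^sup>+y. ennreal (q t x y) * (\<integral>\<^sup>+z. ennreal (q s y z) * indicator C z \<partial>m) \<partial>m)"
    and q_symmetric: "0 < t \<Longrightarrow> u \<in> borel_measurable borel \<Longrightarrow> v \<in> borel_measurable borel \<Longrightarrow>
          (\<integral>\<^sup>+x. u x * (\<integral>\<^sup>+y. ennreal (q t x y) * v y \<partial>m) \<partial>m)
            = (\<integral>\<^sup>+x. (\<integral>\<^sup>+y. ennreal (q t x y) * u y \<partial>m) * v x \<partial>m)"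
    and q_bound: "0 < t \<Longrightarrow> t \<le> 1 \<Longrightarrow> q t x y \<le> c * t powr - \<alpha>"
    and q_initial: "continuous_on UNIV (f :: 'a \<Rightarrow> real) \<Longrightarrow> (\<And>x. \<bar>f x\<bar> \<le> b) \<Longrightarrow>
          (\<And>n. 0 < e n) \<Longrightarrow> e \<longlonglongrightarrow> 0 \<Longrightarrow> (\<lambda>n. \<integral>y. q (e n) x y * f y \<partial>m) \<longlonglongrightarrow> f x"
    and q_right_continuous: "continuous_on UNIV f \<Longrightarrow> (\<And>x. \<bar>f x\<bar> \<le> b) \<Longrightarrow> 0 < t \<Longrightarrow>
          (\<And>n. 0 < e n) \<Longrightarrow> e \<longlonglongrightarrow> 0 \<Longrightarrow>
          (\<lambda>n. \<integral>y. q (t + e n) x y * f y \<partial>m) \<longlonglongrightarrow> (\<integral>y. q t x y * f y \<partial>m)"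
begin

section \<open>Contraction estimates and the pointwise semigroup identity\<close>

lemma space_m: "space m = UNIV"
  using sets_eq_imp_space_eq[OF sets_m] by simp

lemma borel_measurable_m: "borel_measurable m = (borel_measurable borel :: ('a \<Rightarrow> 'c::topological_space) set)"
  by (rule measurable_cong_sets[OF sets_m refl])

lemma q_comp_measurable:
  assumes "0 < t" "f \<in> measurable N m" "g \<in> measurable N m"
  shows "(\<lambda>z. q t (f z) (g z)) \<in> borel_measurable N"
proof -
  have "(\<lambda>z. (f z, g z)) \<in> measurable N (m \<Otimes>\<^sub>M m)"
    using assms by measurable
  from measurable_compose[OF this q_measurable[OF assms(1)]] show ?thesis by simp
qed

lemma integrable_q: "0 < t \<Longrightarrow> integrable m (q t x)"
  by (intro integrableI_nonneg q_comp_measurable AE_I2 q_nonneg order.strict_trans1[OF q_mass])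
     (auto simp: space_m)

lemma integral_q_le_1: "0 < t \<Longrightarrow> (\<integral>y. q t x y \<partial>m) \<le> 1"
  using q_mass[of t x] q_nonneg nn_integral_eq_integral[OF integrable_q] by simp

lemma integrable_q_mult:
  assumes t: "0 < t" and [measurable]: "f \<in> borel_measurable m" and f: "\<And>y. \<bar>f y\<bar> \<le> b"
  shows "integrable m (\<lambda>y. q t x y * f y)"
proof (rule Bochner_Integration.integrable_bound)
  show "integrable m (\<lambda>y. q t x y * b)"
    using integrable_q[OF t] by simp
  show "(\<lambda>y. q t x y * f y) \<in> borel_measurable m"
    using integrable_q[OF t] by measurable
  show "AE y in m. norm (q t x y * f y) \<le> norm (q t x y * b)"
    unfolding norm_mult real_norm_def abs_mult
    by (intro AE_I2 mult_left_mono order_trans[OF f abs_ge_self]) auto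
qed

lemma integral_q_mult_le:
  assumes t: "0 < t" and "f \<in> borel_measurable m" and f: "\<And>y. \<bar>f y\<bar> \<le> b"
  shows "\<bar>\<integral>y. q t x y * f y \<partial>m\<bar> \<le> b"
proof -
  have b: "0 \<le> b" using f[of undefined] by linarith
  have "\<bar>\<integral>y. q t x y * f y \<partial>m\<bar> \<le> (\<integral>y. \<bar>q t x y * f y\<bar> \<partial>m)"
    by (rule integral_abs_bound)
  also have "\<dots> \<le> (\<integral>y. q t x y * b \<partial>m)"
  proof (rule integral_mono)
    show "integrable m (\<lambda>y. \<bar>q t x y * f y\<bar>)"
      by (intro integrable_abs integrable_q_mult[OF assms])
    show "integrable m (\<lambda>y. q t x y * b)"
      using integrable_q[OF t] by simp
    show "\<bar>q t x y * f y\<bar> \<le> q t x y * b" for y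
      using f q_nonneg[OF t] by (simp add: abs_mult mult_left_mono)
  qed
  also have "\<dots> \<le> b"
    using integral_q_le_1[OF t, of x] b by (simp add: mult_left_le_one_le integral_nonneg_AE q_nonneg[OF t])
  finally show ?thesis .
qed

text \<open>As functions of \<open>z\<close> both sides are densities of the same finite measure,
  hence agree almost everywhere; both are continuous, so full support removes the exceptional set.
  The bound \<open>B\<close> dominates the integral on the right. It is a hypothesis because at this
  point a bound is known only for \<open>s \<le> 1\<close>.\<close>

lemma Chapman_Kolmogorov_if_bounded:
  assumes t: "0 < t" and s: "0 < s" and B: "\<And>y z. q s y z \<le> B"
  shows "q (t + s) x z = (\<integral>y. q t x y * q s y z \<partial>m)"
proof -
  have ts: "0 < t + s" using t s by simp
  note [measurable (raw)] = q_comp_measurable[OF t] q_comp_measurable[OF s] q_comp_measurable[OF ts]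
  have [measurable]: "x \<in> space m" for x by (simp add: space_m)
  have absq: "\<bar>q s y z\<bar> \<le> B" for y z
    using B q_nonneg[OF s] by auto
  define G where "G z = (\<integral>y. q t x y * q s y z \<partial>m)" for z
  have G: "(\<integral>\<^sup>+y. ennreal (q t x y) * ennreal (q s y z) \<partial>m) = ennreal (G z)" for z
    unfolding G_def
    by (subst nn_integral_eq_integral[symmetric])
       (auto intro!: integrable_q_mult[OF t _ absq] simp: q_nonneg[OF t] q_nonneg[OF s] ennreal_mult)
  have contG: "continuous_on UNIV G"
    unfolding G_def
  proof (rule continuous_on_integral_dominated[where w="\<lambda>y. q t x y * B"])
    show "continuous_on UNIV (\<lambda>z. q t x y * q s y z)" for y
      by (intro continuous_intros q_continuous[OF s])
    show "\<bar>q t x y * q s y z\<bar> \<le> q t x y * B" for z y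
      using absq q_nonneg[OF t] by (simp add: abs_mult mult_left_mono)
    show "integrable m (\<lambda>y. q t x y * B)"
      using integrable_q[OF t] by simp
  qed measurable
  then have [measurable]: "G \<in> borel_measurable m"
    unfolding borel_measurable_m by (rule borel_measurable_continuous_onI)
  have "density m (\<lambda>z. ennreal (q (t + s) x z)) = density m (\<lambda>z. ennreal (G z))"
  proof (rule measure_eqI)
    fix C assume "C \<in> sets (density m (\<lambda>z. ennreal (q (t + s) x z)))"
    then have C [measurable]: "C \<in> sets m" by simp
    interpret pair_sigma_finite m m ..
    have "emeasure (density m (\<lambda>z. ennreal (q (t + s) x z))) C
        = (\<integral>\<^sup>+z. ennreal (q (t + s) x z) * indicator C z \<partial>m)"
      by (simp add: emeasure_density)
    also have "\<dots> = (\<integral>\<^sup>+y. ennreal (q t x y) * (\<integral>\<^sup>+z. ennreal (q s y z) * indicator C z \<partial>m) \<partial>m)"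
      using C by (intro q_semigroup t s) (simp add: sets_m)
    also have "\<dots> = (\<integral>\<^sup>+y. (\<integral>\<^sup>+z. ennreal (q t x y) * ennreal (q s y z) * indicator C z \<partial>m) \<partial>m)"
      unfolding mult.assoc by (intro nn_integral_cong nn_integral_cmult[symmetric]) measurable
    also have "\<dots> = (\<integral>\<^sup>+z. (\<integral>\<^sup>+y. ennreal (q t x y) * ennreal (q s y z) * indicator C z \<partial>m) \<partial>m)"
      by (rule Fubini') measurable
    also have "\<dots> = (\<integral>\<^sup>+z. ennreal (G z) * indicator C z \<partial>m)"
      by (simp add: nn_integral_multc G)
    also have "\<dots> = emeasure (density m (\<lambda>z. ennreal (G z))) C"
      by (simp add: emeasure_density)
    finally show "emeasure (density m (\<lambda>z. ennreal (q (t + s) x z))) C = \<dots>" .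
  qed simp
  moreover have "finite_measure (density m (\<lambda>z. ennreal (q (t + s) x z)))"
  proof (rule finite_measureI)
    have "emeasure (density m (\<lambda>z. ennreal (q (t + s) x z))) (space m) = (\<integral>\<^sup>+z. ennreal (q (t + s) x z) \<partial>m)"
      using sets.top[of m] by (subst emeasure_density) (auto simp: space_m)
    then show "emeasure (density m (\<lambda>z. ennreal (q (t + s) x z)))
        (space (density m (\<lambda>z. ennreal (q (t + s) x z)))) \<noteq> \<infinity>"
      using q_mass[OF ts, of x] by (auto simp: top_unique)
  qed
  ultimately have "AE z in m. ennreal (q (t + s) x z) = ennreal (G z)"
    by (subst (asm) sigma_finite_density_unique) (auto intro: finite_measure.axioms(1))
  then have "AE z in m. q (t + s) x z = G z"
    by (rule eventually_mono)
       (auto simp: G_def q_nonneg[OF ts] q_nonneg[OF t] q_nonneg[OF s] intro!: integral_nonneg_AE)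
  then have "q (t + s) x z = G z" for z
    by (intro continuous_AE_eq[OF q_continuous[OF ts] contG _ sets_m support])
  then show ?thesis by (simp add: G_def)
qed

text \<open>The kernel of the last step, of length \<open>s\<close>, is at most
  \<open>c * s powr - \<alpha>\<close>, and averaging it against the sub-probability of the first
  \<open>t - s\<close> cannot increase the bound.\<close>

lemma q_le:
  assumes s: "0 < s" "s \<le> 1" "s \<le> t"
  shows "q t x y \<le> c * s powr - \<alpha>"
proof (cases "s = t")
  case True
  with s show ?thesis using q_bound by simp
next
  case False
  then have ts: "0 < t - s" using s by simp
  have "q (t - s + s) x y = (\<integral>z. q (t - s) x z * q s z y \<partial>m)"
    using ts s by (intro Chapman_Kolmogorov_if_bounded[where B="c * s powr - \<alpha>"] q_bound)
  also have "\<dots> \<le> \<bar>\<integral>z. q (t - s) x z * q s z y \<partial>m\<bar>"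
    by simp
  also have "\<dots> \<le> c * s powr - \<alpha>"
    using s q_bound[of s] q_nonneg[of s]
    by (intro integral_q_mult_le ts q_comp_measurable) (auto simp: space_m)
  finally show ?thesis by simp
qed

text \<open>A bound at one time persists at all later times, so capping the time at 1 gives a single
  function that works for every positive time.\<close>

definition time_bound :: "real \<Rightarrow> real" where
  "time_bound t = c * min t 1 powr - \<alpha>"

lemma q_le_time_bound: "0 < t \<Longrightarrow> q t x y \<le> time_bound t"
  unfolding time_bound_def by (intro q_le) auto

lemma abs_q_le_time_bound: "0 < t \<Longrightarrow> \<bar>q t x y\<bar> \<le> time_bound t"
  using q_le_time_bound q_nonneg by auto

lemma Chapman_Kolmogorov:
  "0 < t \<Longrightarrow> 0 < s \<Longrightarrow> q (t + s) x z = (\<integral>y. q t x y * q s y z \<partial>m)"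
  by (rule Chapman_Kolmogorov_if_bounded[OF _ _ q_le_time_bound])

text \<open>
  Symmetry tested against \<open>q e x\<close> and \<open>q s w\<close>; letting \<open>e\<close> tend to \<open>0\<close> gives the identity for every
  \<open>x\<close>, and not just for almost every one, although continuity in the first variable is not yet known.
\<close>

lemma integral_q_q:
  assumes t: "0 < t" and s: "0 < s"
  shows "(\<integral>z. q t x z * q s w z \<partial>m) = q (s + t) w x"
proof -
  note [measurable (raw)] = q_comp_measurable
  have [measurable]: "x \<in> space m" for x by (simp add: space_m)
  define e where "e n = inverse (real (Suc n))" for n
  have e: "0 < e n" "e \<longlonglongrightarrow> 0" for n
    unfolding e_def using LIMSEQ_inverse_real_of_nat by auto
  interpret pair_sigma_finite m m ..
  \<comment> \<open>\<open>J n z\<close> averages \<open>q t z\<close> with weight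
    \<open>q (e n) x\<close>, so it approximates \<open>q t z x\<close>, whose arguments are in the
    order opposite to \<open>q (e n + t) x z\<close>.\<close>
  define J where "J n z = (\<integral>y. q (e n) x y * q t z y \<partial>m)" for n z
  have J: "(\<integral>\<^sup>+y. ennreal (q t z y) * ennreal (q (e n) x y) \<partial>m) = ennreal (J n z)" for n z
    unfolding J_def using e(1) t
    by (subst nn_integral_eq_integral[symmetric])
       (auto intro!: integrable_q_mult abs_q_le_time_bound simp: q_nonneg ennreal_mult mult.commute)
  have J0: "0 \<le> J n z" for n z
    unfolding J_def using e(1) t by (intro integral_nonneg_AE) (auto simp: q_nonneg)
  have [measurable]: "J n \<in> borel_measurable m" for n
    unfolding J_def using e(1)[of n] t by measurable
  have J_le: "\<bar>J n z\<bar> \<le> time_bound t" for n z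
    unfolding J_def using e(1)[of n] t by (intro integral_q_mult_le abs_q_le_time_bound) measurable
  \<comment> \<open>Two evaluations of the double integral of
    \<open>q (e n) x y * q t y z * q s w z\<close>: integrating out \<open>y\<close> by
    Chapman-Kolmogorov gives the left side, moving the operator at time \<open>t\<close> across by
    symmetry gives the right side.\<close>
  have swap: "(\<integral>z. q s w z * q (e n + t) x z \<partial>m) = (\<integral>z. q s w z * J n z \<partial>m)" for n
  proof -
    have en: "0 < e n" "0 < e n + t" using e(1)[of n] t by auto
    have "(\<integral>\<^sup>+y. ennreal (q (e n) x y) * (\<integral>\<^sup>+z. ennreal (q t y z) * ennreal (q s w z) \<partial>m) \<partial>m)
        = (\<integral>\<^sup>+y. (\<integral>\<^sup>+z. ennreal (q (e n) x y) * ennreal (q t y z) * ennreal (q s w z) \<partial>m) \<partial>m)"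
      unfolding mult.assoc using en t s
      by (intro nn_integral_cong nn_integral_cmult[symmetric]) measurable
    also have "\<dots> = (\<integral>\<^sup>+z. (\<integral>\<^sup>+y. ennreal (q (e n) x y) * ennreal (q t y z) * ennreal (q s w z) \<partial>m) \<partial>m)"
      using en t s by (intro Fubini') measurable
    also have "\<dots> = (\<integral>\<^sup>+z. (\<integral>\<^sup>+y. ennreal (q (e n) x y) * ennreal (q t y z) \<partial>m) * ennreal (q s w z) \<partial>m)"
      using en t s by (simp add: nn_integral_multc)
    also have "\<dots> = (\<integral>\<^sup>+z. ennreal (q s w z * q (e n + t) x z) \<partial>m)"
    proof (rule nn_integral_cong)
      fix z
      have "(\<integral>\<^sup>+y. ennreal (q (e n) x y) * ennreal (q t y z) \<partial>m) = ennreal (q (e n + t) x z)"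
        unfolding Chapman_Kolmogorov[OF en(1) t] using en t
        by (subst nn_integral_eq_integral[symmetric])
           (auto intro!: integrable_q_mult abs_q_le_time_bound simp: q_nonneg ennreal_mult)
      then show "(\<integral>\<^sup>+y. ennreal (q (e n) x y) * ennreal (q t y z) \<partial>m) * ennreal (q s w z)
          = ennreal (q s w z * q (e n + t) x z)"
        using en s by (simp add: ennreal_mult q_nonneg mult.commute)
    qed
    also have "\<dots> = ennreal (\<integral>z. q s w z * q (e n + t) x z \<partial>m)"
      using en s
      by (intro nn_integral_eq_integral integrable_q_mult[OF _ _ abs_q_le_time_bound[OF en(2)]]) (auto simp: q_nonneg)
    finally have L: "(\<integral>\<^sup>+y. ennreal (q (e n) x y) * (\<integral>\<^sup>+z. ennreal (q t y z) * ennreal (q s w z) \<partial>m) \<partial>m)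
        = ennreal (\<integral>z. q s w z * q (e n + t) x z \<partial>m)" .
    have "(\<integral>\<^sup>+y. ennreal (q (e n) x y) * (\<integral>\<^sup>+z. ennreal (q t y z) * ennreal (q s w z) \<partial>m) \<partial>m)
        = (\<integral>\<^sup>+z. (\<integral>\<^sup>+y. ennreal (q t z y) * ennreal (q (e n) x y) \<partial>m) * ennreal (q s w z) \<partial>m)"
    proof (rule q_symmetric[OF t, where u="\<lambda>y. ennreal (q (e n) x y)" and v="\<lambda>z. ennreal (q s w z)"])
      show "(\<lambda>y. ennreal (q (e n) x y)) \<in> borel_measurable borel"
        unfolding borel_measurable_m[symmetric] using en by measurable
      show "(\<lambda>z. ennreal (q s w z)) \<in> borel_measurable borel"
        unfolding borel_measurable_m[symmetric] using s by measurable
    qed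
    also have "\<dots> = (\<integral>\<^sup>+z. ennreal (q s w z * J n z) \<partial>m)"
      using s J0 by (intro nn_integral_cong, simp only: J) (simp add: ennreal_mult q_nonneg mult.commute)
    also have "\<dots> = ennreal (\<integral>z. q s w z * J n z \<partial>m)"
      using s J0 by (intro nn_integral_eq_integral integrable_q_mult[OF _ _ J_le]) (auto simp: q_nonneg)
    finally show ?thesis
      unfolding L using s J0 en
      by (subst (asm) ennreal_inj) (auto intro!: integral_nonneg_AE simp: q_nonneg)
  qed
  have "(\<lambda>n. \<integral>z. q (t + e n) x z * q s w z \<partial>m) \<longlonglongrightarrow> (\<integral>z. q t x z * q s w z \<partial>m)"
    by (rule q_right_continuous[OF q_continuous[OF s] abs_q_le_time_bound[OF s] t e])
  \<comment> \<open>Here the limit is taken under the integral: \<open>q t z\<close> is bounded and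
    continuous, so \<open>q_initial\<close> applies to it for each \<open>z\<close>.\<close>
  moreover have "(\<lambda>n. \<integral>z. q s w z * J n z \<partial>m) \<longlonglongrightarrow> (\<integral>z. q s w z * q t z x \<partial>m)"
  proof (rule integral_dominated_convergence[where w="\<lambda>z. q s w z * time_bound t"])
    show "integrable m (\<lambda>z. q s w z * time_bound t)"
      using integrable_q[OF s] by simp
    show "AE z in m. norm (q s w z * J n z) \<le> q s w z * time_bound t" for n
      using J_le by (auto simp: abs_mult q_nonneg[OF s] intro!: mult_left_mono)
    show "AE z in m. (\<lambda>n. q s w z * J n z) \<longlonglongrightarrow> q s w z * q t z x"
      unfolding J_def using e
      by (intro AE_I2 tendsto_mult_left q_initial[OF q_continuous[OF t] abs_q_le_time_bound[OF t]])
  qed (use s t in measurable)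
  ultimately have "(\<integral>z. q t x z * q s w z \<partial>m) = (\<integral>z. q s w z * q t z x \<partial>m)"
    using swap by (intro LIMSEQ_unique[of "\<lambda>n. \<integral>z. q s w z * J n z \<partial>m"]) (simp_all add: mult.commute add.commute)
  then show ?thesis
    by (simp add: Chapman_Kolmogorov[OF s t])
qed

text \<open>With both times equal to \<open>t / 2\<close>, the integral in
  \<open>integral_q_q\<close> does not change when the two points are exchanged, so neither does its
  value.\<close>

lemma q_sym:
  assumes "0 < t"
  shows "q t x y = q t y x"
proof -
  have "q (t / 2 + t / 2) x y = (\<integral>z. q (t / 2) y z * q (t / 2) x z \<partial>m)"
    using assms by (intro integral_q_q[symmetric]) auto
  also have "\<dots> = (\<integral>z. q (t / 2) x z * q (t / 2) y z \<partial>m)"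
    by (simp add: mult.commute)
  also have "\<dots> = q (t / 2 + t / 2) y x"
    using assms by (intro integral_q_q) auto
  finally show ?thesis by simp
qed

text \<open>Halving the time and using symmetry puts both moving points into the second argument,
  where continuity is known. The dominating function is a constant, integrable because
  \<open>m\<close> is finite.\<close>

lemma q_jointly_continuous:
  assumes "0 < t"
  shows "continuous_on UNIV (\<lambda>(x, y). q t x y)"
proof -
  note [measurable (raw)] = q_comp_measurable
  have [measurable]: "x \<in> space m" for x by (simp add: space_m)
  have t: "0 < t / 2" using assms by simp
  have cont: "continuous_on UNIV (\<lambda>p. q (t / 2) y (g p))" if "continuous_on UNIV g"
    for y and g :: "'a \<times> 'a \<Rightarrow> 'a"
    using continuous_on_compose2[OF q_continuous[OF t] that] by auto
  have "continuous_on UNIV (\<lambda>p. \<integral>y. q (t / 2) y (snd p) * q (t / 2) y (fst p) \<partial>m)"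
  proof (rule continuous_on_integral_dominated[where w="\<lambda>_. time_bound (t / 2) * time_bound (t / 2)"])
    show "\<bar>q (t / 2) y (snd p) * q (t / 2) y (fst p)\<bar> \<le> time_bound (t / 2) * time_bound (t / 2)" for p y
      unfolding abs_mult by (intro mult_mono' abs_q_le_time_bound t) auto
    show "(\<lambda>y. q (t / 2) y (snd p) * q (t / 2) y (fst p)) \<in> borel_measurable m" for p
      using t by measurable
    show "integrable m (\<lambda>_. time_bound (t / 2) * time_bound (t / 2))" by simp
  qed (intro continuous_intros cont)
  moreover have "(\<integral>y. q (t / 2) y (snd p) * q (t / 2) y (fst p) \<partial>m) = (case p of (x, y) \<Rightarrow> q t x y)" for p
  proof -
    have "(\<integral>y. q (t / 2) y (snd p) * q (t / 2) y (fst p) \<partial>m)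
        = (\<integral>y. q (t / 2) (fst p) y * q (t / 2) y (snd p) \<partial>m)"
      using q_sym[OF t] by (intro Bochner_Integration.integral_cong) (auto simp: mult.commute)
    also have "\<dots> = q t (fst p) (snd p)"
      using Chapman_Kolmogorov[OF t t] by simp
    finally show ?thesis by (simp add: case_prod_unfold)
  qed
  ultimately show ?thesis by simp
qed

text \<open>Half of the time is moved into a test function: by symmetry \<open>q (t / 2) y z\<close>
  is continuous in \<open>y\<close>, and it is bounded, so right continuity of the operators at
  \<open>t / 2\<close> passes to the kernel.\<close>

lemma q_right_continuous_time:
  assumes t: "0 < t" and e: "\<And>n. 0 < e n" "e \<longlonglongrightarrow> 0"
  shows "(\<lambda>n. q (t + e n) x z) \<longlonglongrightarrow> q t x z"
proof -
  let ?s = "t / 2"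
  have s: "0 < ?s" using t by simp
  have "(\<lambda>y. q ?s y z) = q ?s z"
    using q_sym[OF s] by auto
  then have "continuous_on UNIV (\<lambda>y. q ?s y z)"
    using q_continuous[OF s, of z] by (simp only:)
  then have "(\<lambda>n. \<integral>y. q (?s + e n) x y * q ?s y z \<partial>m) \<longlonglongrightarrow> (\<integral>y. q ?s x y * q ?s y z \<partial>m)"
    by (rule q_right_continuous[OF _ abs_q_le_time_bound[OF s] s e])
  moreover have "q (t + e n) x z = (\<integral>y. q (?s + e n) x y * q ?s y z \<partial>m)" for n
    using Chapman_Kolmogorov[of "?s + e n" ?s x z] s e(1)[of n] by (simp add: algebra_simps)
  ultimately show ?thesis
    using Chapman_Kolmogorov[OF s s, of x z] by simp
qed

text \<open>Measurability at each fixed time does not give joint measurability. Rounding the time up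
  to a grid leaves countably many times, and right continuity makes the rounded kernels
  converge.\<close>

lemma q_time_space_measurable:
  "(\<lambda>(t, y). indicator {0<..} t * q t x y) \<in> borel_measurable (borel \<Otimes>\<^sub>M m)"
proof -
  have [measurable]: "x \<in> space m" for x by (simp add: space_m)
  \<comment> \<open>For \<open>k\<close> the floor of \<open>t * Suc n\<close> with
    \<open>t > 0\<close>, this is the grid point strictly above \<open>t\<close>, at distance at
    most \<open>1 / Suc n\<close>. The \<open>max 1\<close> keeps the time positive for every
    integer \<open>k\<close>.\<close>
  define r where "r n k = max 1 (real_of_int k + 1) / real (Suc n)" for n :: nat and k :: int
  have r0: "0 < r n k" for n k by (simp add: r_def)
  define u where "u n p = indicator {0<..} (fst p) * q (r n \<lfloor>fst p * real (Suc n)\<rfloor>) x (snd p)"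
    for n and p :: "real \<times> 'a"
  have "u n \<in> borel_measurable (borel \<Otimes>\<^sub>M m)" for n
  proof -
    have "(\<lambda>p. q (r n \<lfloor>fst p * real (Suc n)\<rfloor>) x (snd p)) \<in> borel_measurable (borel \<Otimes>\<^sub>M m)"
    proof (rule measurable_compose_countable[where f="\<lambda>k p. q (r n k) x (snd p)"
          and g="\<lambda>p. \<lfloor>fst p * real (Suc n)\<rfloor>"])
      show "(\<lambda>p. q (r n k) x (snd p)) \<in> borel_measurable (borel \<Otimes>\<^sub>M m)" for k
        by (rule q_comp_measurable[OF r0]) auto
      show "(\<lambda>p :: real \<times> 'a. \<lfloor>fst p * real (Suc n)\<rfloor>) \<in> measurable (borel \<Otimes>\<^sub>M m) (count_space UNIV)"
        by measurable
    qed
    then show ?thesis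
      unfolding u_def by measurable
  qed
  then show ?thesis
  proof (rule borel_measurable_LIMSEQ_real[rotated])
    fix p :: "real \<times> 'a"
    show "(\<lambda>n. u n p) \<longlonglongrightarrow> (case p of (t, y) \<Rightarrow> indicator {0<..} t * q t x y)"
    proof (cases "0 < fst p")
      case True
      let ?t = "fst p"
      define e where "e n = r n \<lfloor>?t * real (Suc n)\<rfloor> - ?t" for n
      have r_eq: "r n \<lfloor>?t * real (Suc n)\<rfloor> = (\<lfloor>?t * real (Suc n)\<rfloor> + 1) / Suc n" for n
        using True by (simp add: r_def max_def)
      have e0: "0 < e n" for n
        unfolding e_def r_eq by (simp add: field_simps) linarith
      have e1: "e n \<le> 1 / Suc n" for n
      proof -
        have "\<lfloor>?t * real (Suc n)\<rfloor> / real (Suc n) \<le> ?t"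
          by (simp only: pos_divide_le_eq of_nat_0_less_iff zero_less_Suc of_int_floor_le)
        then show ?thesis
          unfolding e_def r_eq of_int_add add_divide_distrib by simp
      qed
      have "(\<lambda>n. 1 / real (Suc n)) \<longlonglongrightarrow> 0"
        using LIMSEQ_inverse_real_of_nat by (simp add: inverse_eq_divide)
      then have "e \<longlonglongrightarrow> 0"
        by (rule tendsto_sandwich[OF always_eventually always_eventually tendsto_const, rotated -1])
           (intro allI e1 less_imp_le[OF e0])+
      with e0 have "(\<lambda>n. q (?t + e n) x (snd p)) \<longlonglongrightarrow> q ?t x (snd p)"
        by (intro q_right_continuous_time True)
      then show ?thesis
        using True by (simp add: u_def e_def case_prod_unfold)
    qed (simp add: u_def case_prod_unfold)
  qed
qed

end

section \<open>Verification of Assumption (A)\<close>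

lemma ennreal_add_power_le:
  fixes a b :: ennreal
  shows "(a + b) ^ n \<le> 2 ^ n * (a ^ n + b ^ n)"
proof -
  have "(a + b) ^ n \<le> (2 * max a b) ^ n"
    by (intro power_mono) (auto simp: mult_2 max_def intro!: add_mono)
  also have "\<dots> = 2 ^ n * max a b ^ n"
    by (rule power_mult_distrib)
  also have "\<dots> \<le> 2 ^ n * (a ^ n + b ^ n)"
    by (intro mult_left_mono) (auto simp: max_def add_increasing add_increasing2)
  finally show ?thesis .
qed

lemma nn_integral_exp_minus: "(\<integral>\<^sup>+t\<in>{0<..}. ennreal (exp (- t)) \<partial>lborel) \<le> 1"
proof -
  have "((\<lambda>t::real. exp (- t)) has_integral 1) {0..}"
    using has_integral_exp_minus_to_infinity[of 1 0] by simp
  then have "(\<integral>\<^sup>+t\<in>{0..}. ennreal (exp (- t)) \<partial>lborel) = ennreal 1"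
    by (intro nn_integral_has_integral_lebesgue') auto
  moreover have "(\<integral>\<^sup>+t\<in>{0<..}. ennreal (exp (- t)) \<partial>lborel) \<le> (\<integral>\<^sup>+t\<in>{0..}. ennreal (exp (- t)) \<partial>lborel)"
    by (intro nn_integral_mono) (auto simp: indicator_def)
  ultimately show ?thesis by simp
qed

context bounded_density
begin

lemma q_slice_measurable: "0 < t \<Longrightarrow> q t x \<in> borel_measurable m"
  using integrable_q by blast

lemma c_nonneg: "0 \<le> c"
  using q_bound[of 1 undefined undefined] q_nonneg[of 1 undefined undefined] by simp

section \<open>Uniform tightness of the resolvent (A1)\<close>

lemma assumption_A1I:
  fixes P :: "'a option \<Rightarrow> 'w measure"
  assumes lc: "locally_compact_space (euclidean :: 'a topology)"
    and P: "\<And>t x. 0 < t \<Longrightarrow> trans_prob P X t x = density m (\<lambda>y. ennreal (q t x y))"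
  shows "assumption_A1 P X"
  unfolding assumption_A1_def
proof (intro allI impI)
  fix \<epsilon> :: real assume eps: "0 < \<epsilon>"
  \<comment> \<open>Times up to \<open>d\<close> contribute at most \<open>d\<close>, hence at most
    half of \<epsilon>; \<open>d \<le> 1\<close> allows \<open>q_le\<close> with
    \<open>s = d\<close>.\<close>
  define d where "d = min 1 (\<epsilon> / 2)"
  have d: "0 < d" "d \<le> 1" "d \<le> \<epsilon> / 2" using eps by (auto simp: d_def)
  define B where "B = c * d powr - \<alpha>"
  have B: "0 \<le> B" using c_nonneg by (simp add: B_def)
  \<comment> \<open>\<open>B\<close> may be 0, so \<open>B + 1\<close> serves as the
    divisor.\<close>
  have "0 < \<epsilon> / (2 * (B + 1))" using eps B by simp
  then obtain K where K: "compact K" "measure m (- K) < \<epsilon> / (2 * (B + 1))"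
    using sigma_compact_approximation[OF lc finite_measure_axioms sets_m] by blast
  have "B * measure m (- K) \<le> (B + 1) * measure m (- K)"
    by (intro mult_right_mono) auto
  also have "\<dots> \<le> \<epsilon> / 2"
    using K(2) B by (simp add: field_simps)
  finally have BK: "B * measure m (- K) \<le> \<epsilon> / 2" .
  have Ks: "- K \<in> sets m"
    unfolding sets_m using K(1) by (intro borel_open open_Compl compact_imp_closed)
  have "resolvent1 P X (indicator (- K)) x \<le> ennreal \<epsilon>" for x
  proof -
    have pK: "(\<integral>\<^sup>+y. indicator (- K) y \<partial>trans_prob P X t x) = (\<integral>\<^sup>+y. ennreal (q t x y) * indicator (- K) y \<partial>m)"
      if "0 < t" for t
      using Ks q_slice_measurable[OF that, of x] by (subst P[OF that], subst nn_integral_density) auto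
    have pK1: "(\<integral>\<^sup>+y. indicator (- K) y \<partial>trans_prob P X t x) \<le> 1" if "0 < t" for t
    proof -
      have "(\<integral>\<^sup>+y. ennreal (q t x y) * indicator (- K) y \<partial>m) \<le> (\<integral>\<^sup>+y. ennreal (q t x y) \<partial>m)"
        by (intro nn_integral_mono) (auto simp: indicator_def)
      also have "\<dots> \<le> 1"
        by (rule q_mass[OF that])
      finally show ?thesis unfolding pK[OF that] .
    qed
    have pK2: "(\<integral>\<^sup>+y. indicator (- K) y \<partial>trans_prob P X t x) \<le> ennreal (\<epsilon> / 2)" if "d < t" for t
    proof -
      have t: "0 < t" using that d by simp
      have "(\<integral>\<^sup>+y. ennreal (q t x y) * indicator (- K) y \<partial>m) \<le> (\<integral>\<^sup>+y. ennreal B * indicator (- K) y \<partial>m)"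
        unfolding B_def using that d by (intro nn_integral_mono mult_right_mono ennreal_leI q_le) auto
      also have "\<dots> = ennreal (B * measure m (- K))"
        using Ks B by (simp add: nn_integral_cmult emeasure_eq_measure ennreal_mult)
      also have "\<dots> \<le> ennreal (\<epsilon> / 2)"
        using BK by (rule ennreal_leI)
      finally show ?thesis unfolding pK[OF t] .
    qed
    have "resolvent1 P X (indicator (- K)) x
        \<le> (\<integral>\<^sup>+t. indicator {0<..d} t + ennreal (\<epsilon> / 2) * (ennreal (exp (- t)) * indicator {0<..} t) \<partial>lborel)"
      unfolding resolvent1_def
    proof (rule nn_integral_mono)
      fix t :: real
      show "ennreal (exp (- t)) * (\<integral>\<^sup>+y. indicator (- K) y \<partial>trans_prob P X t x) * indicator {0<..} t
          \<le> indicator {0<..d} t + ennreal (\<epsilon> / 2) * (ennreal (exp (- t)) * indicator {0<..} t)"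
      proof (cases "t \<in> {0<..d}")
        case True
        then have "ennreal (exp (- t)) * (\<integral>\<^sup>+y. indicator (- K) y \<partial>trans_prob P X t x) \<le> 1 * 1"
          using pK1[of t] by (intro mult_mono) (auto intro: ennreal_le_1[THEN iffD2])
        with True show ?thesis by (simp add: add_increasing2)
      next
        case False
        show ?thesis
        proof (cases "0 < t")
          case True
          with False pK2[of t] show ?thesis
            by (simp add: mult.commute mult_left_mono)
        qed simp
      qed
    qed
    also have "\<dots> = (\<integral>\<^sup>+t. indicator {0<..d} t \<partial>lborel)
        + ennreal (\<epsilon> / 2) * (\<integral>\<^sup>+t\<in>{0<..}. ennreal (exp (- t)) \<partial>lborel)"
      by (simp add: nn_integral_add nn_integral_cmult)
    also have "\<dots> \<le> ennreal (\<epsilon> / 2) + ennreal (\<epsilon> / 2) * 1"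
      using d by (intro add_mono mult_left_mono nn_integral_exp_minus) (auto intro: ennreal_leI)
    also have "\<dots> = ennreal \<epsilon>"
      using eps by (simp add: ennreal_plus[symmetric] del: ennreal_plus)
    finally show ?thesis .
  qed
  with K(1) show "\<exists>K. compact K \<and> (SUP x. resolvent1 P X (indicator (- K)) x) \<le> ennreal \<epsilon>"
    by (blast intro: SUP_least)
qed

section \<open>Heat trace asymptotics (A3) and ultracontractivity (A4)\<close>

lemma assumption_A3I:
  assumes c1: "0 < c1" and \<alpha>: "0 < \<alpha>" and lower: "\<And>t x. t \<in> {0<..1} \<Longrightarrow> c1 * t powr - \<alpha> \<le> q t x x"
  shows "assumption_A3 m q"
proof -
  define M where "M = measure m UNIV"
  have em: "emeasure m UNIV = ennreal M"
    using emeasure_eq_measure by (simp add: M_def)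
  have "0 < emeasure m UNIV"
    using support by (auto simp: measure_support_def)
  then have M: "0 < M"
    by (simp add: em)
  have const: "(\<integral>\<^sup>+x. ennreal r \<partial>m) = ennreal (r * M)" if "0 \<le> r" for r
    using that M by (simp add: space_m em ennreal_mult)
  \<comment> \<open>Integrating the diagonal bounds puts the trace between \<open>c1 * M\<close> and
    \<open>c * M\<close> times \<open>t powr - \<alpha>\<close>; \<open>C\<close> majorizes the
    reciprocal of the first constant and the second one itself.\<close>
  define C where "C = max (1 / (c1 * M)) (c * M)"
  have C: "0 < C" "1 / (c1 * M) \<le> C" "c * M \<le> C"
    using c1 M by (auto simp: C_def less_max_iff_disj)
  have "inverse C \<le> c1 * M"
    using C(2) c1 M C(1) by (simp add: field_simps)
  then have "ennreal (inverse C * t powr - \<alpha>) \<le> (\<integral>\<^sup>+x. ennreal (q t x x) \<partial>m)"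
    and "(\<integral>\<^sup>+x. ennreal (q t x x) \<partial>m) \<le> ennreal (C * t powr - \<alpha>)" if t: "t \<in> {0<..1}" for t
  proof -
    have "inverse C * t powr - \<alpha> \<le> c1 * t powr - \<alpha> * M"
      using \<open>inverse C \<le> c1 * M\<close> mult_right_mono[of "inverse C" "c1 * M" "t powr - \<alpha>"] by (simp add: ac_simps)
    then have "ennreal (inverse C * t powr - \<alpha>) \<le> ennreal (c1 * t powr - \<alpha> * M)"
      by (rule ennreal_leI)
    also have "\<dots> = (\<integral>\<^sup>+x. ennreal (c1 * t powr - \<alpha>) \<partial>m)"
      using c1 by (intro const[symmetric]) auto
    also have "\<dots> \<le> (\<integral>\<^sup>+x. ennreal (q t x x) \<partial>m)"
      using lower[OF t] by (intro nn_integral_mono ennreal_leI)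
    finally show "ennreal (inverse C * t powr - \<alpha>) \<le> (\<integral>\<^sup>+x. ennreal (q t x x) \<partial>m)" .
    have "(\<integral>\<^sup>+x. ennreal (q t x x) \<partial>m) \<le> (\<integral>\<^sup>+x. ennreal (c * t powr - \<alpha>) \<partial>m)"
      using t by (intro nn_integral_mono ennreal_leI q_bound) auto
    also have "\<dots> = ennreal (c * M * t powr - \<alpha>)"
      using c_nonneg by (subst const) (auto simp: ac_simps)
    also have "\<dots> \<le> ennreal (C * t powr - \<alpha>)"
      by (intro ennreal_leI mult_right_mono C) auto
    finally show "(\<integral>\<^sup>+x. ennreal (q t x x) \<partial>m) \<le> ennreal (C * t powr - \<alpha>)" .
  qed
  then show ?thesis
    unfolding assumption_A3_def using C(1) \<alpha>
    by (intro exI[of _ "2 * \<alpha>"] exI[of _ 1] exI[of _ C] conjI) auto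
qed

text \<open>Pulling the supremum of the kernel out of the integral leaves the L1 norm of
  \<open>f\<close>, so the bound holds at every point and therefore essentially.\<close>

lemma norm_L1_Linf_le:
  fixes P :: "'a option \<Rightarrow> 'w measure"
  assumes P: "\<And>x. trans_prob P X t x = density m (\<lambda>y. ennreal (q t x y))"
    and t: "0 < t" "t \<le> 1"
  shows "norm_L1_Linf m (semigroup_op P X t) \<le> ereal (c * t powr - \<alpha>)"
  unfolding norm_L1_Linf_def
proof (rule SUP_least, safe)
  fix f :: "'a \<Rightarrow> real"
  assume f: "integrable m f" and f1: "(\<integral>x. \<bar>f x\<bar> \<partial>m) \<le> 1"
  note [measurable] = borel_measurable_integrable[OF f]
  note [measurable (raw)] = q_comp_measurable[OF t(1)]
  have [measurable]: "x \<in> space m" for x by (simp add: space_m)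
  let ?b = "c * t powr - \<alpha>"
  have b: "0 \<le> ?b" using c_nonneg by simp
  have T: "semigroup_op P X t f x = (\<integral>y. q t x y * f y \<partial>m)" for x
    unfolding semigroup_op_def P using q_nonneg[OF t(1)]
    by (subst integral_density) auto
  have le: "\<bar>q t x y * f y\<bar> \<le> ?b * \<bar>f y\<bar>" for x y
    using q_bound[OF t] q_nonneg[OF t(1)] by (simp add: abs_mult mult_right_mono)
  have "\<bar>semigroup_op P X t f x\<bar> \<le> ?b" for x
  proof -
    have int: "integrable m (\<lambda>y. ?b * \<bar>f y\<bar>)" using f by simp
    have int': "integrable m (\<lambda>y. \<bar>q t x y * f y\<bar>)"
    proof (rule Bochner_Integration.integrable_bound[OF int])
      show "AE y in m. norm \<bar>q t x y * f y\<bar> \<le> norm (?b * \<bar>f y\<bar>)"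
        using le[of x] c_nonneg by (auto simp: abs_mult)
    qed measurable
    have "\<bar>semigroup_op P X t f x\<bar> \<le> (\<integral>y. \<bar>q t x y * f y\<bar> \<partial>m)"
      unfolding T by (rule integral_abs_bound)
    also have "\<dots> \<le> (\<integral>y. ?b * \<bar>f y\<bar> \<partial>m)"
      by (intro integral_mono int int' le)
    also have "\<dots> \<le> ?b"
      using f1 b mult_left_mono[of "\<integral>y. \<bar>f y\<bar> \<partial>m" 1 ?b] by simp
    finally show ?thesis .
  qed
  moreover have "(\<lambda>x. ereal \<bar>semigroup_op P X t f x\<bar>) \<in> borel_measurable m"
    unfolding T by measurable
  ultimately show "esssup m (\<lambda>x. ereal \<bar>semigroup_op P X t f x\<bar>) \<le> ereal ?b"
    by (intro esssup_I) auto
qed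

lemma assumption_A4I:
  fixes P :: "'a option \<Rightarrow> 'w measure"
  assumes P: "\<And>t x. 0 < t \<Longrightarrow> trans_prob P X t x = density m (\<lambda>y. ennreal (q t x y))"
    and c: "0 < c" and p: "2 \<le> p" and \<alpha>: "(real p - 1) * \<alpha> < real p"
  shows "assumption_A4 P X m p"
proof -
  let ?u = "2 * real p / (real p - 1)"
  have "2 < ?u" "2 * \<alpha> < ?u"
    using p \<alpha> by (auto simp: field_simps)
  \<comment> \<open>Raising \<open>2 * \<alpha>\<close> to \<mu> only weakens the bound for
    \<open>t \<le> 1\<close>, and it secures \<open>2 < \<mu>\<close> even when \<alpha> is at most
    1.\<close>
  then obtain \<mu> where \<mu>: "2 < \<mu>" "2 * \<alpha> < \<mu>" "\<mu> < ?u"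
    using dense[of "max 2 (2 * \<alpha>)" ?u] by auto
  have "norm_L1_Linf m (semigroup_op P X t) \<le> ereal (c * t powr (- \<mu> / 2))" if t: "t \<in> {0<..1}" for t
  proof -
    have "norm_L1_Linf m (semigroup_op P X t) \<le> ereal (c * t powr - \<alpha>)"
      using t by (intro norm_L1_Linf_le P) auto
    also have "\<dots> \<le> ereal (c * t powr (- \<mu> / 2))"
      using t c \<mu> by (auto intro!: mult_left_mono powr_mono')
    finally show ?thesis .
  qed
  then show ?thesis
    unfolding assumption_A4_def using \<mu> c
    by (intro bexI[of _ \<mu>] exI[of _ c] exI[of _ 1] conjI) auto
qed

section \<open>Integrability of powers of the resolvent kernel (A5)\<close>

lemma nn_integral_q_power_le:
  assumes t: "0 < t" "t \<le> 1"
  shows "(\<integral>\<^sup>+y. ennreal (q t x y ^ Suc k) \<partial>m) \<le> ennreal (c ^ k * t powr (- \<alpha> * k))"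
proof -
  have "(\<integral>\<^sup>+y. ennreal (q t x y ^ Suc k) \<partial>m)
      \<le> (\<integral>\<^sup>+y. ennreal ((c * t powr - \<alpha>) ^ k) * ennreal (q t x y) \<partial>m)"
  proof (rule nn_integral_mono)
    fix y
    have "q t x y ^ Suc k \<le> (c * t powr - \<alpha>) ^ k * q t x y"
      using q_nonneg[OF t(1)] q_bound[OF t]
      by (simp add: mult.commute mult_left_mono power_mono)
    then show "ennreal (q t x y ^ Suc k) \<le> ennreal ((c * t powr - \<alpha>) ^ k) * ennreal (q t x y)"
      using c_nonneg q_nonneg[OF t(1)] by (simp add: ennreal_mult[symmetric] ennreal_leI del: power_Suc)
  qed
  also have "\<dots> = ennreal ((c * t powr - \<alpha>) ^ k) * (\<integral>\<^sup>+y. ennreal (q t x y) \<partial>m)"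
    using q_slice_measurable[OF t(1), of x] by (intro nn_integral_cmult) measurable
  also have "\<dots> \<le> ennreal ((c * t powr - \<alpha>) ^ k) * 1"
    by (intro mult_left_mono q_mass t) auto
  also have "(c * t powr - \<alpha>) ^ k = c ^ k * t powr (- \<alpha> * k)"
    using t by (simp add: power_mult_distrib powr_power mult.commute)
  finally show ?thesis by simp
qed

lemma q_time_measurable: "(\<lambda>t. indicator {0<..} t * q t x y) \<in> borel_measurable borel"
proof -
  have "(\<lambda>t. (t, y)) \<in> measurable borel (borel \<Otimes>\<^sub>M m)"
    by (simp add: space_m)
  from measurable_compose[OF this q_time_space_measurable] show ?thesis by simp
qed

text \<open>
  Hoelder's inequality in time with the weight \<open>t powr - b\<close> replaces a power of the time integral
  by a time integral of powers; here \<open>b < 1\<close> makes the weight integrable, and \<open>k * (b - \<alpha>) > -1\<close> the result.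
\<close>

lemma nn_integral_resolvent1_density_upto_power_le:
  assumes b: "b < 1" "- 1 < k * (b - \<alpha>)" and d: "0 \<le> d" "d \<le> 1"
  shows "(\<integral>\<^sup>+y. resolvent1_density_upto q d x y ^ Suc k \<partial>m)
           \<le> ennreal ((d powr (1 - b) / (1 - b)) ^ k * (c ^ k / (k * (b - \<alpha>) + 1)))"
proof -
  let ?W = "ennreal (d powr (1 - b) / (1 - b))"
  let ?v = "\<lambda>t y. ennreal (t powr (b * k) * q t x y ^ Suc k) * indicator {0<..d} t"
  have pointwise: "resolvent1_density_upto q d x y ^ Suc k \<le> ?W ^ k * (\<integral>\<^sup>+t. ?v t y \<partial>lborel)" for y
  proof -
    have "resolvent1_density_upto q d x y \<le> (\<integral>\<^sup>+t\<in>{0<..d}. ennreal (q t x y) \<partial>lborel)"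
      unfolding resolvent1_density_upto_def
      by (intro nn_integral_mono) (auto simp: indicator_def q_nonneg intro!: ennreal_leI mult_left_le_one_le)
    then have "resolvent1_density_upto q d x y ^ Suc k \<le> (\<integral>\<^sup>+t\<in>{0<..d}. ennreal (q t x y) \<partial>lborel) ^ Suc k"
      by (rule power_mono) simp
    also have "\<dots> \<le> ?W ^ k * (\<integral>\<^sup>+t. ?v t y \<partial>lborel)"
      by (intro nn_integral_interval_power_le q_time_measurable q_nonneg b d)
    finally show ?thesis .
  qed
  \<comment> \<open>Joint measurability was shown for the kernel cut off to positive times; on
    \<open>{0<..d}\<close> the cutoff changes nothing.\<close>
  have v_eq: "?v t y = ennreal (t powr (b * k) * (indicator {0<..} t * q t x y) ^ Suc k) * indicator {0<..d} t" for t y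
    by (auto simp: indicator_def)
  have [measurable]: "(\<lambda>(t, y). indicator {0<..} t * q t x y) \<in> borel_measurable (lborel \<Otimes>\<^sub>M m)"
    using q_time_space_measurable measurable_cong_sets[OF sets_pair_measure_cong[OF sets_lborel refl] refl] by blast
  have vm: "(\<lambda>(t, y). ?v t y) \<in> borel_measurable (lborel \<Otimes>\<^sub>M m)"
  proof -
    have "(\<lambda>z. (case z of (t, y) \<Rightarrow> indicator {0<..} t * q t x y)) \<in> borel_measurable (lborel \<Otimes>\<^sub>M m)"
      by measurable
    then have "(\<lambda>z. ennreal (fst z powr (b * k) * (case z of (t, y) \<Rightarrow> indicator {0<..} t * q t x y) ^ Suc k)
        * indicator {0<..d} (fst z)) \<in> borel_measurable (lborel \<Otimes>\<^sub>M m)"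
      by measurable
    then show ?thesis
      unfolding v_eq by (simp add: case_prod_unfold)
  qed
  have v1: "(\<lambda>y. \<integral>\<^sup>+t. ?v t y \<partial>lborel) \<in> borel_measurable m"
  proof -
    interpret pair_sigma_finite lborel m ..
    show ?thesis
      using lborel.borel_measurable_nn_integral_fst[OF measurable_pair_swap[OF vm]] by simp
  qed
  have "(\<integral>\<^sup>+y. resolvent1_density_upto q d x y ^ Suc k \<partial>m) \<le> (\<integral>\<^sup>+y. ?W ^ k * (\<integral>\<^sup>+t. ?v t y \<partial>lborel) \<partial>m)"
    by (intro nn_integral_mono pointwise)
  also have "\<dots> = ?W ^ k * (\<integral>\<^sup>+y. (\<integral>\<^sup>+t. ?v t y \<partial>lborel) \<partial>m)"
    by (rule nn_integral_cmult[OF v1])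
  also have "(\<integral>\<^sup>+y. (\<integral>\<^sup>+t. ?v t y \<partial>lborel) \<partial>m) = (\<integral>\<^sup>+t. (\<integral>\<^sup>+y. ?v t y \<partial>m) \<partial>lborel)"
  proof -
    interpret pair_sigma_finite lborel m ..
    show ?thesis by (rule Fubini'[OF vm])
  qed
  \<comment> \<open>Enlarging the time range to \<open>{0<..1}\<close> makes this factor independent
    of \<open>d\<close>. The dependence on \<open>d\<close> stays in the mass of the weight.\<close>
  also have "\<dots> \<le> (\<integral>\<^sup>+t. ennreal (c ^ k) * (ennreal (t powr (k * (b - \<alpha>))) * indicator {0<..1} t) \<partial>lborel)"
  proof (rule nn_integral_mono)
    fix t :: real
    show "(\<integral>\<^sup>+y. ?v t y \<partial>m) \<le> ennreal (c ^ k) * (ennreal (t powr (k * (b - \<alpha>))) * indicator {0<..1} t)"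
    proof (cases "t \<in> {0<..d}")
      case True
      then have t: "0 < t" "t \<le> 1" using d by auto
      have "(\<integral>\<^sup>+y. ?v t y \<partial>m) = (\<integral>\<^sup>+y. ennreal (t powr (b * k)) * ennreal (q t x y ^ Suc k) \<partial>m)"
        using True by (intro nn_integral_cong) (simp add: ennreal_mult q_nonneg t del: power_Suc)
      also have "\<dots> = ennreal (t powr (b * k)) * (\<integral>\<^sup>+y. ennreal (q t x y ^ Suc k) \<partial>m)"
        using q_slice_measurable[OF t(1), of x] by (intro nn_integral_cmult) measurable
      also have "\<dots> \<le> ennreal (t powr (b * k)) * ennreal (c ^ k * t powr (- \<alpha> * k))"
        by (intro mult_left_mono nn_integral_q_power_le t) auto
      also have "\<dots> = ennreal (c ^ k * t powr (k * (b - \<alpha>)))"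
        using c_nonneg by (simp add: ennreal_mult[symmetric] powr_add[symmetric] algebra_simps)
      also have "\<dots> = ennreal (c ^ k) * (ennreal (t powr (k * (b - \<alpha>))) * indicator {0<..1} t)"
        using c_nonneg t by (simp add: ennreal_mult)
      finally show ?thesis .
    next
      case False
      then have "(\<integral>\<^sup>+y. ?v t y \<partial>m) = 0" by simp
      then show ?thesis by simp
    qed
  qed
  also have "\<dots> = ennreal (c ^ k) * (\<integral>\<^sup>+t\<in>{0<..1}. ennreal (t powr (k * (b - \<alpha>))) \<partial>lborel)"
    by (intro nn_integral_cmult) measurable
  also have "\<dots> = ennreal (c ^ k / (k * (b - \<alpha>) + 1))"
    using b c_nonneg by (subst nn_integral_powr_from_0) (auto simp: ennreal_mult[symmetric])
  also have "?W ^ k * ennreal (c ^ k / (k * (b - \<alpha>) + 1))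
      = ennreal ((d powr (1 - b) / (1 - b)) ^ k * (c ^ k / (k * (b - \<alpha>) + 1)))"
    using b c_nonneg by (subst ennreal_power, simp, subst ennreal_mult) auto
  finally show ?thesis
    by (simp add: mult_left_mono)
qed

text \<open>Past time 1 the kernel is at most \<open>c\<close> by \<open>q_le\<close>, and the
  exponential weight has integral at most 1. Only the singular short-time part is left to
  estimate.\<close>

lemma resolvent1_density_le: "resolvent1_density q x y \<le> resolvent1_density_upto q 1 x y + ennreal c"
proof -
  have [measurable]: "(\<lambda>t. indicator {0<..} t * q t x y) \<in> borel_measurable lborel"
    using q_time_measurable by simp
  have eq: "resolvent1_density_upto q 1 x y
      = (\<integral>\<^sup>+t. ennreal (exp (- t) * (indicator {0<..} t * q t x y)) * indicator {..1} t \<partial>lborel)"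
    unfolding resolvent1_density_upto_def by (intro nn_integral_cong) (auto simp: indicator_def)
  have "resolvent1_density q x y \<le> (\<integral>\<^sup>+t. ennreal (exp (- t) * (indicator {0<..} t * q t x y)) * indicator {..1} t
      + ennreal c * (ennreal (exp (- t)) * indicator {0<..} t) \<partial>lborel)"
    unfolding resolvent1_density_def
  proof (rule nn_integral_mono)
    fix t :: real
    have "q t x y \<le> c" if "1 < t"
      using q_le[of 1 t x y] that by simp
    then show "ennreal (exp (- t) * q t x y) * indicator {0<..} t
        \<le> ennreal (exp (- t) * (indicator {0<..} t * q t x y)) * indicator {..1} t
          + ennreal c * (ennreal (exp (- t)) * indicator {0<..} t)"
      using c_nonneg by (auto simp: indicator_def ennreal_mult[symmetric] mult.commute intro!: ennreal_leI mult_left_mono)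
  qed
  also have "\<dots> = resolvent1_density_upto q 1 x y + ennreal c * (\<integral>\<^sup>+t\<in>{0<..}. ennreal (exp (- t)) \<partial>lborel)"
    unfolding eq by (subst nn_integral_add; simp add: nn_integral_cmult)
  also have "\<dots> \<le> resolvent1_density_upto q 1 x y + ennreal c * 1"
    by (intro add_left_mono mult_left_mono nn_integral_exp_minus) auto
  finally show ?thesis by simp
qed

lemma assumption_A5I:
  assumes p: "2 \<le> p" and \<alpha>: "(real p - 1) * \<alpha> < real p"
  shows "assumption_A5 m q p"
proof -
  obtain k where k: "p = Suc k" "1 \<le> k"
    using p by (cases p) auto
  \<comment> \<open>The range for \<open>b\<close> is nonempty exactly when
    \<open>k * \<alpha> < k + 1\<close>, the hypothesis for \<open>p = Suc k\<close>. Its lower end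
    makes \<open>t powr (k * (b - \<alpha>))\<close> integrable at 0, its upper end the weight
    \<open>t powr - b\<close>.\<close>
  have "\<alpha> - 1 / k < 1"
    using \<alpha> k by (simp add: field_simps)
  then obtain b where b': "\<alpha> - 1 / k < b" "b < 1"
    using dense by blast
  then have b: "b < 1" "- 1 < k * (b - \<alpha>)"
    using k by (auto simp: field_simps)
  define D where "D = c ^ k / (k * (b - \<alpha>) + 1)"
  define G where "G d = (d powr (1 - b) / (1 - b)) ^ k * D" for d
  have le: "(\<integral>\<^sup>+y. resolvent1_density_upto q d x y ^ p \<partial>m) \<le> ennreal (G d)" if "0 \<le> d" "d \<le> 1" for d x
    unfolding G_def D_def k by (intro nn_integral_resolvent1_density_upto_power_le b that)
  have up_measurable: "(\<lambda>y. resolvent1_density_upto q 1 x y) \<in> borel_measurable m" for x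
  proof -
    interpret pair_sigma_finite lborel m ..
    have 1: "(\<lambda>(t, y). indicator {0<..} t * q t x y) \<in> borel_measurable (lborel \<Otimes>\<^sub>M m)"
      using q_time_space_measurable measurable_cong_sets[OF sets_pair_measure_cong[OF sets_lborel refl] refl] by blast
    have "(\<lambda>z. ennreal (exp (- fst z) * (case z of (t, y) \<Rightarrow> indicator {0<..} t * q t x y)) * indicator {..1} (fst z))
        \<in> borel_measurable (lborel \<Otimes>\<^sub>M m)"
      using 1 by measurable
    from lborel.borel_measurable_nn_integral_fst[OF measurable_pair_swap[OF this]]
    have "(\<lambda>y. \<integral>\<^sup>+t. ennreal (exp (- t) * (indicator {0<..} t * q t x y)) * indicator {..1} t \<partial>lborel) \<in> borel_measurable m"
      by simp
    moreover have "(\<integral>\<^sup>+t. ennreal (exp (- t) * (indicator {0<..} t * q t x y)) * indicator {..1} t \<partial>lborel)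
        = resolvent1_density_upto q 1 x y" for y
      unfolding resolvent1_density_upto_def by (intro nn_integral_cong) (auto simp: indicator_def)
    ultimately show ?thesis by simp
  qed
  have "(\<integral>\<^sup>+y. resolvent1_density q x y ^ p \<partial>m) \<le> 2 ^ p * (ennreal (G 1) + ennreal (c ^ p) * emeasure m UNIV)" for x
  proof -
    have "(\<integral>\<^sup>+y. resolvent1_density q x y ^ p \<partial>m)
        \<le> (\<integral>\<^sup>+y. 2 ^ p * (resolvent1_density_upto q 1 x y ^ p + ennreal c ^ p) \<partial>m)"
      by (intro nn_integral_mono order_trans[OF power_mono[OF resolvent1_density_le] ennreal_add_power_le]) auto
    also have "\<dots> = 2 ^ p * ((\<integral>\<^sup>+y. resolvent1_density_upto q 1 x y ^ p \<partial>m) + ennreal c ^ p * emeasure m UNIV)"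
      using up_measurable[of x] by (simp add: nn_integral_cmult nn_integral_add space_m)
    also have "\<dots> \<le> 2 ^ p * (ennreal (G 1) + ennreal (c ^ p) * emeasure m UNIV)"
      using c_nonneg by (intro mult_left_mono add_mono le) (auto simp: ennreal_power)
    finally show ?thesis .
  qed
  then have "(SUP x. \<integral>\<^sup>+y. resolvent1_density q x y ^ p \<partial>m)
      \<le> 2 ^ p * (ennreal (G 1) + ennreal (c ^ p) * emeasure m UNIV)"
    by (intro SUP_least)
  also have "\<dots> < \<infinity>"
    by (simp add: emeasure_eq_measure ennreal_mult_less_top power_less_top_ennreal)
  finally have first: "(SUP x. \<integral>\<^sup>+y. resolvent1_density q x y ^ p \<partial>m) < \<infinity>" .
  \<comment> \<open>The mass of the weight vanishes as \<open>d\<close> tends to 0 because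
    \<open>1 - b\<close> is positive; \<open>k \<ge> 1\<close> carries this over to
    \<open>G\<close>.\<close>
  have "((\<lambda>d. d powr (1 - b)) \<longlongrightarrow> 0) (at_right 0)"
    using b by (intro tendsto_zero_powrI[where b="1 - b"]) (auto intro!: tendsto_intros simp: eventually_at_filter)
  then have "(G \<longlongrightarrow> (0 / (1 - b)) ^ k * D) (at_right 0)"
    unfolding G_def by (intro tendsto_intros) (use b in auto)
  then have lim: "((\<lambda>d. ennreal (G d)) \<longlongrightarrow> ennreal 0) (at_right 0)"
    using k by (intro tendsto_ennrealI) (auto simp: zero_power)
  have "eventually (\<lambda>d::real. d \<in> {0<..<1}) (at_right 0)"
    by (rule eventually_at_right_real) simp
  then have ev: "eventually (\<lambda>d. (SUP x. \<integral>\<^sup>+y. resolvent1_density_upto q d x y ^ p \<partial>m) \<le> ennreal (G d)) (at_right 0)"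
    by eventually_elim (intro SUP_least le; simp)
  have "((\<lambda>d. SUP x. \<integral>\<^sup>+y. resolvent1_density_upto q d x y ^ p \<partial>m) \<longlongrightarrow> 0) (at_right 0)"
    by (rule tendsto_sandwich[OF _ ev tendsto_const lim[unfolded ennreal_0]]) (intro always_eventually allI zero_le)
  with first show ?thesis
    by (simp add: assumption_A5_def)
qed

end

section \<open>Reduction of the process to its kernel, and conclusion\<close>

theorem proposition7p2:
  fixes \<Omega> :: "'w set" and F :: "ennreal \<Rightarrow> 'w measure"
    and X :: "ennreal \<Rightarrow> 'w \<Rightarrow> 'a::{metric_space, second_countable_topology} option"
    and P :: "'a option \<Rightarrow> 'w measure" and \<theta> :: "ennreal \<Rightarrow> 'w \<Rightarrow> 'w"
    and m :: "'a measure" and q :: "real \<Rightarrow> 'a \<Rightarrow> 'a \<Rightarrow> real"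
    and c\<^sub>1 c\<^sub>2 c\<^sub>3 c\<^sub>4 d\<^sub>f d\<^sub>w :: real and p :: nat
  assumes "locally_compact_space (euclidean :: 'a topology)"
    and "connected (UNIV :: 'a set)"
    and "bounded (UNIV :: 'a set)" and "diameter (UNIV :: 'a set) = 1"
    and "emeasure m UNIV < \<infinity>" and "measure_support m = UNIV"
    and "symmetric_hunt_process \<Omega> F X P \<theta> m"
    and "transition_density P X m q"
    and "\<And>t x. 0 < t \<Longrightarrow> continuous_on UNIV (q t x)"
    and "0 < c\<^sub>1" and "0 < c\<^sub>2" and "0 < c\<^sub>3" and "0 < c\<^sub>4" and "1 \<le> d\<^sub>f" and "2 \<le> d\<^sub>w"
    and "\<And>x t. t \<in> {0<..1} \<Longrightarrow> c\<^sub>1 * t powr (- d\<^sub>f / d\<^sub>w) \<le> q t x x"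
    and "\<And>x y t. t \<in> {0<..1} \<Longrightarrow>
           q t x y \<le> c\<^sub>2 * (if x = y then t powr (- d\<^sub>f / d\<^sub>w)
                             else min (t powr (- d\<^sub>f / d\<^sub>w)) (t / dist x y powr (d\<^sub>f + d\<^sub>w)))"
    and "\<And>x r. r \<in> {0<..1} \<Longrightarrow>
           ennreal (c\<^sub>3 * r powr d\<^sub>f) \<le> emeasure m (ball x r) \<and>
           emeasure m (ball x r) \<le> ennreal (c\<^sub>4 * r powr d\<^sub>f)"
    and "2 \<le> p" and "0 < d\<^sub>f - real p * (d\<^sub>f - d\<^sub>w)"
  shows "assumption_A P X m q p"
proof -
  interpret symmetric_hunt_process \<Omega> F X P \<theta> m by fact
  have td: "(\<lambda>(x, y). q t x y) \<in> borel_measurable (m \<Otimes>\<^sub>M m)" "0 \<le> q t x y"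
      "trans_prob P X t x = density m (\<lambda>y. ennreal (q t x y))" if "0 < t" for t x y
    using assms(8) that by (auto simp: transition_density_def)
  have space_m: "space m = UNIV"
    using sets_eq_imp_space_eq[OF sets_m] by simp
  have qm: "q t x \<in> borel_measurable m" if "0 < t" for t x
    using measurable_Pair2[OF td(1)[OF that], of x] by (simp add: space_m)
  have qm' [measurable]: "(\<lambda>y. ennreal (q t x y)) \<in> borel_measurable m" if "0 < t" for t x
    using qm[OF that] by measurable
  have int: "(\<integral>y. f y \<partial>trans_prob P X t x) = (\<integral>y. q t x y * f y \<partial>m)"
    if "0 < t" "continuous_on UNIV f" for t x and f :: "'a \<Rightarrow> real"
  proof -
    have "f \<in> borel_measurable m"
      using borel_measurable_continuous_onI[OF that(2)] measurable_cong_sets[OF sets_m refl] by blast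
    then show ?thesis
      using td(2)[OF that(1)] qm[OF that(1)] by (simp add: td(3)[OF that(1)] integral_density)
  qed
  interpret bounded_density m q c\<^sub>2 "d\<^sub>f / d\<^sub>w"
  proof (intro bounded_density.intro finite_measureI bounded_density_axioms.intro)
    show "emeasure m (space m) \<noteq> \<infinity>"
      using assms(5) by (simp add: space_m)
    show "(\<integral>\<^sup>+y. ennreal (q t x y) \<partial>m) \<le> 1" if "0 < t" for t x
      using emeasure_trans_prob_le_1[of t x UNIV] qm'[OF that] sets.top[of m]
      by (simp add: td(3)[OF that] emeasure_density space_m)
    show "(\<integral>\<^sup>+z. ennreal (q (t + s) x z) * indicator C z \<partial>m)
        = (\<integral>\<^sup>+y. ennreal (q t x y) * (\<integral>\<^sup>+z. ennreal (q s y z) * indicator C z \<partial>m) \<partial>m)"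
      if "0 < t" "0 < s" "C \<in> sets borel" for t s C x
    proof -
      have C: "C \<in> sets m" using that(3) by (simp add: sets_m)
      have ts: "0 < t + s" using that by simp
      have em: "emeasure (trans_prob P X r y) C = (\<integral>\<^sup>+z. ennreal (q r y z) * indicator C z \<partial>m)" if "0 < r" for r y
        using C qm'[OF that] by (simp add: td(3)[OF that] emeasure_density)
      have "(\<lambda>y. ennreal (measure (trans_prob P X s y) C)) \<in> borel_measurable m"
        using measure_trans_prob_measurable[OF that(3), of s] measurable_cong_sets[OF sets_m refl]
        by (intro measurable_compose[OF _ measurable_ennreal]) blast
      then have "(\<lambda>y. emeasure (trans_prob P X s y) C) \<in> borel_measurable m"
        by (simp add: finite_measure.emeasure_eq_measure[OF finite_measure_trans_prob])
      then have "(\<integral>\<^sup>+y. emeasure (trans_prob P X s y) C \<partial>trans_prob P X t x)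
          = (\<integral>\<^sup>+y. ennreal (q t x y) * emeasure (trans_prob P X s y) C \<partial>m)"
        using qm'[OF that(1)] by (simp only: td(3)[OF that(1), of x] nn_integral_density)
      with emeasure_trans_prob_Markov[of t s C x] that show ?thesis
        by (simp add: em[OF that(2)] em[OF ts])
    qed
    show "(\<integral>\<^sup>+x. u x * (\<integral>\<^sup>+y. ennreal (q t x y) * v y \<partial>m) \<partial>m)
        = (\<integral>\<^sup>+x. (\<integral>\<^sup>+y. ennreal (q t x y) * u y \<partial>m) * v x \<partial>m)"
      if "0 < t" "u \<in> borel_measurable borel" "v \<in> borel_measurable borel" for t u v
    proof -
      have "u \<in> borel_measurable m" "v \<in> borel_measurable m"
        using that measurable_cong_sets[OF sets_m refl] by blast+
      then show ?thesis
        using symmetric[OF that] qm'[OF that(1)] by (simp add: td(3)[OF that(1)] nn_integral_density)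
    qed
    show "q t x y \<le> c\<^sub>2 * t powr - (d\<^sub>f / d\<^sub>w)" if "0 < t" "t \<le> 1" for t x y
    proof -
      have "q t x y \<le> c\<^sub>2 * (if x = y then t powr (- d\<^sub>f / d\<^sub>w)
          else min (t powr (- d\<^sub>f / d\<^sub>w)) (t / dist x y powr (d\<^sub>f + d\<^sub>w)))"
        using that by (intro assms(17)) simp
      also have "\<dots> \<le> c\<^sub>2 * t powr (- d\<^sub>f / d\<^sub>w)"
        using \<open>0 < c\<^sub>2\<close> by (intro mult_left_mono) auto
      finally show ?thesis by simp
    qed
    \<comment> \<open>Right continuity at time 0, where normality of the process identifies the
      limit as \<open>f x\<close>.\<close>
    show "(\<lambda>n. \<integral>y. q (e n) x y * f y \<partial>m) \<longlonglongrightarrow> f x"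
      if "continuous_on UNIV f" "\<And>x. \<bar>f x\<bar> \<le> b" "\<And>n. 0 < e n" "e \<longlonglongrightarrow> 0" for f :: "'a \<Rightarrow> real" and b e x
      using integral_trans_prob_right_continuous[OF that(1,2) order_refl that(3,4), of x]
        integral_trans_prob_0[OF borel_measurable_continuous_onI[OF that(1)]] int[OF that(3,1)]
      by simp
    show "(\<lambda>n. \<integral>y. q (t + e n) x y * f y \<partial>m) \<longlonglongrightarrow> (\<integral>y. q t x y * f y \<partial>m)"
      if "continuous_on UNIV f" "\<And>x. \<bar>f x\<bar> \<le> b" "0 < t" "\<And>n. 0 < e n" "e \<longlonglongrightarrow> 0"
      for f :: "'a \<Rightarrow> real" and b t e x
      using integral_trans_prob_right_continuous[OF that(1,2) less_imp_le[OF that(3)] that(4,5), of x]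
        int[OF that(3,1)] int[OF add_pos_pos[OF that(3) that(4)] that(1)]
      by simp
  qed (use td assms sets_m in auto)
  \<comment> \<open>The dimension condition says \<open>(p - 1) * d\<^sub>f < p * d\<^sub>w\<close>;
    divide by \<open>d\<^sub>w\<close>.\<close>
  have \<alpha>: "(real p - 1) * (d\<^sub>f / d\<^sub>w) < real p"
    using assms(15,20) by (simp add: field_simps)
  have "assumption_A1 P X"
    using assms(1) td(3) by (rule assumption_A1I)
  moreover have "assumption_A2 P X m q"
    unfolding assumption_A2_def
  proof (intro conjI allI impI)
    fix t :: real assume t: "0 < t"
    show "absolutely_continuous m (trans_prob P X t x)" for x
      unfolding td(3)[OF t] using qm'[OF t] by (rule absolutely_continuousI_density)
    show "continuous_on UNIV (\<lambda>(x, y). q t x y)"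
      by (rule q_jointly_continuous[OF t])
    show "bounded (range (\<lambda>(x, y). q t x y))"
      unfolding bounded_iff using abs_q_le_time_bound[OF t] by auto
  qed (rule assms(8))
  moreover have "assumption_A3 m q"
    using assms(10,14,15,16) by (intro assumption_A3I[of c\<^sub>1]) auto
  moreover have "assumption_A4 P X m p"
    using td(3) \<open>0 < c\<^sub>2\<close> \<open>2 \<le> p\<close> \<alpha> by (rule assumption_A4I)
  moreover have "assumption_A5 m q p"
    using \<open>2 \<le> p\<close> \<alpha> by (rule assumption_A5I)
  ultimately show ?thesis
    by (simp add: assumption_A_def)
qed

end
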